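(* For an interval order $R$ let $(T_1,S_1,R)$ be its F1-triple. For every $n\ge0$, the pair of statistics $(\mathrm{max}(S_1),\mathrm{max}(R))$ has symmetric joint distribution over the set $\mathcal{F}_n$ of (isomorphism classes of) interval orders on $n$ elements; that is, for all $k,\ell$ the number of $R\in\mathcal{F}_n$ with $\mathrm{max}(S_1)=k$ and $\mathrm{max}(R)=\ell$ equals the number with $\mathrm{max}(S_1)=\ell$ and $\mathrm{max}(R)=k$.
   Context: For a relation $Q$ on $X$, $x$ is $Q$-maximal if there is no $y$ with $xQy$; $\mathrm{max}(Q)$ is the number of $Q$-maximal elements. An interval order is a $\mathbf{2+2}$-free poset (no four elements with only the relations $a<b$, $c<d$). It has a unique minimal interval representation $x\mapsto[l_x,r_x]$ with positive integer endpoints, $x\prec y$ iff $r_x<l_y$, every $k\in\{1,\dots,m\}$ both a left and a right endpoint; its Fishburn matrix $M$ is $m\times m$ with $M_{i,j}=|\{x:[l_x,r_x]=[i,j]\}|$ (rows top to bottom), $x$ represented by cell $c_x=(i,j)$, $X_c$ the set of elements represented by $c$. For cells $c=(i,j)$, $c'=(i',j')$: $c$ greater than $c'$ if $j'<i$, comparable if one is greater; South $i>i'$, $j=j'$; North $i<i'$, $j=j'$; West $i=i'$, $j<j'$; strictly SW $i>i'$, $j<j'$; strictly NW: incomparable with $i<i'$, $j<j'$; weakly SW: South, West or strictly SW. The F1-triple $(T_1,S_1,R)$ of $R$: for $x,y$ in distinct cells, $xT_1y$ iff $c_x$ strictly NW from $c_y$, and $xS_1y$ iff $c_x$ weakly SW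 from $c_y$; on each $X_c$, $S_1$ restricts to a linear order and $T_1$ has no pairs. *)

theory Defs
  imports Complex_Main
begin

text \<open>Posets are given by their strict order relation: an element is maximal when it has no successor at all,
  so a reflexive relation would have no maximal elements.\<close>

definition two_plus_two_free :: "'a set \<Rightarrow> 'a rel \<Rightarrow> bool" where
  "two_plus_two_free X R \<longleftrightarrow>
     \<not> (\<exists>a\<in>X. \<exists>b\<in>X. \<exists>c\<in>X. \<exists>d\<in>X. distinct [a, b, c, d] \<and> Restr R {a, b, c, d} = {(a, b), (c, d)})"

definition interval_order_on :: "'a set \<Rightarrow> 'a rel \<Rightarrow> bool" where
  "interval_order_on X R \<longleftrightarrow> R \<subseteq> X \<times> X \<and> irrefl R \<and> trans R \<and> two_plus_two_free X R"

definition num_max :: "'a set \<Rightarrow> 'a rel \<Rightarrow> nat" where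
  "num_max X Q = card {x \<in> X. \<not> (\<exists>y\<in>X. (x, y) \<in> Q)}"


text \<open>The element \<open>x\<close> is represented by the interval \<open>[l x, r x]\<close>. Only the values of \<open>l\<close> and \<open>r\<close> on \<open>X\<close> matter;
  they are uniquely determined (\<open>minimal_representation_unique\<close>).\<close>

definition minimal_representation ::
    "'a set \<Rightarrow> 'a rel \<Rightarrow> nat \<Rightarrow> ('a \<Rightarrow> nat) \<Rightarrow> ('a \<Rightarrow> nat) \<Rightarrow> bool" where
  "minimal_representation X R m l r \<longleftrightarrow>
     (\<forall>x\<in>X. l x \<le> r x) \<and>
     (\<forall>x\<in>X. \<forall>y\<in>X. (x, y) \<in> R \<longleftrightarrow> r x < l y) \<and>
     l ` X = {1..m} \<and> r ` X = {1..m}"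

text \<open>A cell is a pair (row, column) with rows numbered from top to bottom. In each of the following
  relations the first argument is the cell whose position relative to the second one is described.\<close>

type_synonym cell = "nat \<times> nat"

definition cell_greater :: "cell \<Rightarrow> cell \<Rightarrow> bool" where
  "cell_greater c c' \<longleftrightarrow> snd c' < fst c"

definition cell_comparable :: "cell \<Rightarrow> cell \<Rightarrow> bool" where
  "cell_comparable c c' \<longleftrightarrow> cell_greater c c' \<or> cell_greater c' c"

definition cell_South :: "cell \<Rightarrow> cell \<Rightarrow> bool" where
  "cell_South c c' \<longleftrightarrow> fst c > fst c' \<and> snd c = snd c'"

definition cell_West :: "cell \<Rightarrow> cell \<Rightarrow> bool" where
  "cell_West c c' \<longleftrightarrow> fst c = fst c' \<and> snd c < snd c'"

definition strictly_SW :: "cell \<Rightarrow> cell \<Rightarrow> bool" where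
  "strictly_SW c c' \<longleftrightarrow> fst c > fst c' \<and> snd c < snd c'"

definition strictly_NW :: "cell \<Rightarrow> cell \<Rightarrow> bool" where
  "strictly_NW c c' \<longleftrightarrow> \<not> cell_comparable c c' \<and> fst c < fst c' \<and> snd c < snd c'"

definition weakly_SW :: "cell \<Rightarrow> cell \<Rightarrow> bool" where
  "weakly_SW c c' \<longleftrightarrow> cell_South c c' \<or> cell_West c c' \<or> strictly_SW c c'"

definition cell_of :: "('a \<Rightarrow> nat) \<Rightarrow> ('a \<Rightarrow> nat) \<Rightarrow> 'a \<Rightarrow> cell" where
  "cell_of l r x = (l x, r x)"

definition cell_elements :: "'a set \<Rightarrow> ('a \<Rightarrow> nat) \<Rightarrow> ('a \<Rightarrow> nat) \<Rightarrow> cell \<Rightarrow> 'a set" where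
  "cell_elements X l r c = {x \<in> X. cell_of l r x = c}"

text \<open>The linear orders on the sets of elements sharing a cell are arbitrary, so being the F1-triple of \<open>R\<close> is
  a predicate; \<open>num_max X S\<close> does not depend on their choice (\<open>num_max_F1_cong\<close>).\<close>

definition F1_triple :: "'a set \<Rightarrow> 'a rel \<Rightarrow> 'a rel \<Rightarrow> 'a rel \<Rightarrow> bool" where
  "F1_triple X T S R \<longleftrightarrow> T \<subseteq> X \<times> X \<and> S \<subseteq> X \<times> X \<and>
     (\<exists>m l r. minimal_representation X R m l r \<and>
        (\<forall>x\<in>X. \<forall>y\<in>X. cell_of l r x \<noteq> cell_of l r y \<longrightarrow>
           ((x, y) \<in> T \<longleftrightarrow> strictly_NW (cell_of l r x) (cell_of l r y)) \<and>
           ((x, y) \<in> S \<longleftrightarrow> weakly_SW (cell_of l r x) (cell_of l r y))) \<and>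
        (\<forall>c. strict_linear_order_on (cell_elements X l r c) (Restr S (cell_elements X l r c)) \<and>
             Restr T (cell_elements X l r c) = {}))"


definition poset_iso :: "'a set \<Rightarrow> 'a rel \<Rightarrow> 'b set \<Rightarrow> 'b rel \<Rightarrow> ('a \<Rightarrow> 'b) \<Rightarrow> bool" where
  "poset_iso X R Y R' f \<longleftrightarrow>
     bij_betw f X Y \<and> (\<forall>x\<in>X. \<forall>y\<in>X. (x, y) \<in> R \<longleftrightarrow> (f x, f y) \<in> R')"

definition isomorphic_orders :: "nat \<Rightarrow> nat rel rel" where
  "isomorphic_orders n = {(R, R'). interval_order_on {..<n} R \<and> interval_order_on {..<n} R' \<and>
     (\<exists>f. poset_iso {..<n} R {..<n} R' f)}"

definition interval_order_classes :: "nat \<Rightarrow> nat rel set set" where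
  "interval_order_classes n = {R. interval_order_on {..<n} R} // isomorphic_orders n"

text \<open>The values of the two statistics on an isomorphism class; well-definedness is shown in
  \<open>max_R_class\<close>, \<open>F1_triple_exists\<close> and \<open>max_S1_class\<close>.\<close>

definition max_R :: "nat \<Rightarrow> nat rel set \<Rightarrow> nat" where
  "max_R n C = (THE k. \<exists>R\<in>C. num_max {..<n} R = k)"

definition max_S1 :: "nat \<Rightarrow> nat rel set \<Rightarrow> nat" where
  "max_S1 n C = (THE k. \<exists>R\<in>C. \<exists>T S. F1_triple {..<n} T S R \<and> num_max {..<n} S = k)"


definition down :: "'a set \<Rightarrow> 'a rel \<Rightarrow> 'a \<Rightarrow> 'a set" where
  "down X R y = {x \<in> X. (x, y) \<in> R}"

lemma interval_order_down_chain:
  assumes "interval_order_on X R" "y \<in> X" "z \<in> X"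
  shows "down X R y \<subseteq> down X R z \<or> down X R z \<subseteq> down X R y"
proof (rule ccontr)
  assume "\<not> ?thesis"
  then obtain a c where a: "a \<in> X" "(a, y) \<in> R" "(a, z) \<notin> R"
    and c: "c \<in> X" "(c, z) \<in> R" "(c, y) \<notin> R"
    by (auto simp: down_def)
  have tr: "\<And>u v w. (u, v) \<in> R \<Longrightarrow> (v, w) \<in> R \<Longrightarrow> (u, w) \<in> R"
    and ir: "\<And>u. (u, u) \<notin> R"
    using assms(1) unfolding interval_order_on_def irrefl_def by (auto dest: transD)
  have d: "distinct [a, y, c, z]"
    using a c tr ir by auto
  have "(a, c) \<notin> R" "(c, a) \<notin> R" "(y, a) \<notin> R" "(y, c) \<notin> R" "(y, z) \<notin> R" "(z, a) \<notin> R" "(z, c) \<notin> R" "(z, y) \<notin> R"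
    using a c tr ir by blast+
  then have "Restr R {a, y, c, z} = {(a, y), (c, z)}"
    using a c ir by auto
  then show False
    using assms d a c unfolding interval_order_on_def two_plus_two_free_def by blast
qed

lemma minimal_representation_formulas:
  assumes "minimal_representation X R m l r" "x \<in> X"
  shows "l x = card {D \<in> down X R ` X. D \<subseteq> down X R x}"
    and "r x = card {D \<in> down X R ` X. x \<notin> D}"
proof -
  have rel: "\<And>x y. x \<in> X \<Longrightarrow> y \<in> X \<Longrightarrow> (x, y) \<in> R \<longleftrightarrow> r x < l y"
    and lX: "l ` X = {1..m}" and rX: "r ` X = {1..m}"
    using assms unfolding minimal_representation_def by auto
  define E where "E k = {x \<in> X. r x < k}" for k
  have dE: "down X R y = E (l y)" if "y \<in> X" for y
    using that rel by (auto simp: down_def E_def)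
  have E_iff: "E i \<subseteq> E j \<longleftrightarrow> i \<le> j" if "i \<in> {1..m}" "j \<in> {1..m}" for i j
  proof
    assume sub: "E i \<subseteq> E j"
    have "j \<in> r ` X" unfolding rX by (fact that(2))
    then obtain z where z: "z \<in> X" "r z = j" by blast
    show "i \<le> j"
    proof (rule ccontr)
      assume "\<not> i \<le> j"
      then have "z \<in> E i" using z by (auto simp: E_def)
      then show False using sub z by (auto simp: E_def)
    qed
  qed (auto simp: E_def)
  have inj: "inj_on E {1..m}"
    proof (rule inj_onI)
    fix i j assume ij: "i \<in> {1..m}" "j \<in> {1..m}" "E i = E j"
    then have "i \<le> j" "j \<le> i" using E_iff[OF ij(1,2)] E_iff[OF ij(2,1)] by auto
    then show "i = j" by simp
  qed
  have im: "down X R ` X = E ` {1..m}"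
  proof -
    have "down X R ` X = (\<lambda>x. E (l x)) ` X" by (rule image_cong[OF refl dE])
    also have "\<dots> = E ` (l ` X)" by (simp only: image_image)
    finally show ?thesis by (simp only: lX)
  qed
  have lx: "l x \<in> {1..m}" and rx: "r x \<in> {1..m}" using assms(2) lX rX by blast+
  have "{D \<in> down X R ` X. D \<subseteq> down X R x} = E ` {1..l x}"
  proof -
    have "{k \<in> {1..m}. E k \<subseteq> E (l x)} = {1..l x}"
    proof (intro equalityI subsetI)
      fix k assume "k \<in> {k \<in> {1..m}. E k \<subseteq> E (l x)}"
      then show "k \<in> {1..l x}" using E_iff[OF _ lx, of k] by simp
    next
      fix k assume "k \<in> {1..l x}"
      then show "k \<in> {k \<in> {1..m}. E k \<subseteq> E (l x)}" using E_iff[OF _ lx, of k] lx by simp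
    qed
    then show ?thesis unfolding im dE[OF assms(2)] by blast
  qed
  moreover have "inj_on E {1..l x}" using lx by (intro inj_on_subset[OF inj]) simp
  ultimately show "l x = card {D \<in> down X R ` X. D \<subseteq> down X R x}"
    by (simp add: card_image)
  have "{D \<in> down X R ` X. x \<notin> D} = E ` {1..r x}"
  proof -
    have "{k \<in> {1..m}. x \<notin> E k} = {1..r x}"
      using rx assms(2) by (auto simp: E_def)
    then show ?thesis unfolding im by blast
  qed
  moreover have "inj_on E {1..r x}" using rx by (intro inj_on_subset[OF inj]) simp
  ultimately show "r x = card {D \<in> down X R ` X. x \<notin> D}"
    by (simp add: card_image)
qed

lemma minimal_representation_unique:
  assumes "minimal_representation X R m l r" "minimal_representation X R m' l' r'" "x \<in> X"
  shows "l x = l' x" "r x = r' x"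
  using minimal_representation_formulas[OF assms(1,3)] minimal_representation_formulas[OF assms(2,3)] by simp_all

lemma chain_rank_bij:
  assumes "finite \<D>" "\<And>A B. A \<in> \<D> \<Longrightarrow> B \<in> \<D> \<Longrightarrow> A \<subseteq> B \<or> B \<subseteq> A"
  shows "bij_betw (\<lambda>D. card {E \<in> \<D>. E \<subseteq> D}) \<D> {1..card \<D>}"
proof -
  let ?f = "\<lambda>D. card {E \<in> \<D>. E \<subseteq> D}"
  have "inj_on ?f \<D>"
  proof (rule inj_onI)
    fix A B assume A: "A \<in> \<D>" and B: "B \<in> \<D>" and eq: "?f A = ?f B"
    have *: "U = V" if "U \<in> \<D>" "V \<in> \<D>" "U \<subseteq> V" "?f U = ?f V" for U V
    proof -
      have "{E \<in> \<D>. E \<subseteq> U} = {E \<in> \<D>. E \<subseteq> V}"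
        using that assms(1) by (intro card_subset_eq) auto
      then show ?thesis using that by blast
    qed
    show "A = B" using assms(2)[OF A B] *[OF A B] *[OF B A] eq by auto
  qed
  moreover have "?f ` \<D> \<subseteq> {1..card \<D>}"
  proof
    fix k assume "k \<in> ?f ` \<D>"
    then obtain D where D: "D \<in> \<D>" "k = ?f D" by auto
    have "k > 0" using D assms(1) by (auto simp: card_gt_0_iff)
    moreover have "k \<le> card \<D>" using D assms(1) by (auto intro: card_mono)
    ultimately show "k \<in> {1..card \<D>}" by auto
  qed
  ultimately show ?thesis
    unfolding bij_betw_def by (simp add: card_subset_eq card_image)
qed

lemma minimal_representation_exists:
  assumes "finite X" "interval_order_on X R"
  shows "\<exists>m l r. minimal_representation X R m l r"
proof -
  let ?D = "down X R ` X"
  define f where "f D = card {E \<in> ?D. E \<subseteq> D}" for D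
  define l where "l x = f (down X R x)" for x
  define r where "r x = card {D \<in> ?D. x \<notin> D}" for x
  let ?m = "card ?D"
  have ir: "\<And>u. (u, u) \<notin> R"
    using assms(2) unfolding interval_order_on_def irrefl_def by auto
  have chain: "A \<subseteq> B \<or> B \<subseteq> A" if "A \<in> ?D" "B \<in> ?D" for A B
    using that interval_order_down_chain[OF assms(2)] by auto
  have fin: "finite ?D" using assms(1) by auto
  have bij: "bij_betw f ?D {1..?m}"
    unfolding f_def by (rule chain_rank_bij[OF fin chain])
  have lX: "l ` X = {1..?m}"
    using bij unfolding bij_betw_def l_def by (simp add: image_image)
  have rel: "x \<in> A \<longleftrightarrow> r x < f A" if "x \<in> X" "A \<in> ?D" for x A
  proof
    assume "x \<in> A"
    then have "{D \<in> ?D. x \<notin> D} \<subset> {E \<in> ?D. E \<subseteq> A}" using that chain by blast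
    then show "r x < f A" unfolding r_def f_def using fin by (intro psubset_card_mono) auto
  next
    assume lt: "r x < f A"
    show "x \<in> A"
    proof (rule ccontr)
      assume "x \<notin> A"
      then have "{E \<in> ?D. E \<subseteq> A} \<subseteq> {D \<in> ?D. x \<notin> D}" by blast
      then have "f A \<le> r x" unfolding r_def f_def using fin by (intro card_mono) auto
      then show False using lt by simp
    qed
  qed
  have rel': "(x, y) \<in> R \<longleftrightarrow> r x < l y" if "x \<in> X" "y \<in> X" for x y
    using rel[OF that(1), of "down X R y"] that by (auto simp: l_def down_def)
  have le: "l x \<le> r x" if "x \<in> X" for x
    using rel'[OF that that] ir by auto
  have rm: "r x \<le> ?m" for x
    unfolding r_def using fin by (intro card_mono) auto
  have "r ` X = {1..?m}"
  proof
    show "r ` X \<subseteq> {1..?m}"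
    proof
      fix k assume "k \<in> r ` X"
      then obtain x where x: "x \<in> X" "k = r x" by auto
      then have "1 \<le> l x" using lX by (metis atLeastAtMost_iff imageI)
      then show "k \<in> {1..?m}" using le[OF x(1)] rm[of x] x by auto
    qed
    show "{1..?m} \<subseteq> r ` X"
    proof
      fix k assume k: "k \<in> {1..?m}"
      then obtain A where A: "A \<in> ?D" "f A = k" using bij by (metis bij_betw_def imageE)
      show "k \<in> r ` X"
      proof (cases "k = ?m")
        case True
        have "X \<noteq> {}" using A by auto
        have "\<exists>x\<in>X. \<forall>y\<in>X. (x, y) \<notin> R"
        proof -
          have "Max (r ` X) \<in> r ` X" using \<open>X \<noteq> {}\<close> assms(1) by simp
          then obtain x where x: "x \<in> X" "r x = Max (r ` X)" by auto
          have "(x, y) \<notin> R" if y: "y \<in> X" for y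
          proof -
            have "r y \<le> r x" using x y assms(1) by auto
            then show ?thesis using rel'[OF x(1) y] le[OF y] by auto
          qed
          then show ?thesis using x by auto
        qed
        then obtain x where x: "x \<in> X" "\<forall>y\<in>X. (x, y) \<notin> R" by auto
        then have "{D \<in> ?D. x \<notin> D} = ?D" by (auto simp: down_def)
        then have "r x = k" using True r_def by simp
        then show ?thesis using x by auto
      next
        case False
        then have "k + 1 \<in> {1..?m}" using k by auto
        then obtain B where B: "B \<in> ?D" "f B = k + 1" using bij by (metis bij_betw_def imageE)
        have "\<not> B \<subseteq> A"
        proof
          assume "B \<subseteq> A"
          then have "f B \<le> f A" unfolding f_def using fin by (intro card_mono) auto
          then show False using A B by simp
        qed
        then obtain x where x: "x \<in> B" "x \<notin> A" by auto
        then have xX: "x \<in> X" using B by (auto simp: down_def)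
        have "r x < k + 1" using rel[OF xX B(1)] x B by simp
        moreover have "\<not> r x < k" using rel[OF xX A(1)] x A by simp
        ultimately have "r x = k" by simp
        then show ?thesis using xX by auto
      qed
    qed
  qed
  then have "minimal_representation X R ?m l r"
    unfolding minimal_representation_def using le rel' lX by auto
  then show ?thesis by blast
qed

lemma F1_triple_exists:
  fixes X :: "'a::linorder set"
  assumes "finite X" "interval_order_on X R"
  shows "\<exists>T S. F1_triple X T S R"
proof -
  obtain m l r where mr: "minimal_representation X R m l r"
    using minimal_representation_exists[OF assms] by blast
  let ?c = "cell_of l r"
  define T where "T = {(x, y) \<in> X \<times> X. strictly_NW (?c x) (?c y)}"
  define S where "S = {(x, y) \<in> X \<times> X. if ?c x = ?c y then x < y else weakly_SW (?c x) (?c y)}"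
  have nw: "\<not> strictly_NW e e" for e
    by (simp add: strictly_NW_def)
  have T: "Restr T (cell_elements X l r c) = {}" for c
    using nw[of c] by (auto simp: T_def cell_elements_def)
  have "Restr S (cell_elements X l r c) = {(x, y). x \<in> cell_elements X l r c \<and> y \<in> cell_elements X l r c \<and> x < y}" for c
    by (auto simp: S_def cell_elements_def)
  moreover have "strict_linear_order_on A {(x, y). x \<in> A \<and> y \<in> A \<and> x < y}" for A :: "'a set"
    unfolding strict_linear_order_on_def trans_def irrefl_def total_on_def by auto
  ultimately have S: "strict_linear_order_on (cell_elements X l r c) (Restr S (cell_elements X l r c))" for c
    by simp
  have sub: "T \<subseteq> X \<times> X" "S \<subseteq> X \<times> X"
    by (auto simp: T_def S_def)
  have "\<forall>x\<in>X. \<forall>y\<in>X. ?c x \<noteq> ?c y \<longrightarrow>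
      ((x, y) \<in> T \<longleftrightarrow> strictly_NW (?c x) (?c y)) \<and> ((x, y) \<in> S \<longleftrightarrow> weakly_SW (?c x) (?c y))"
    by (simp add: T_def S_def)
  then have "F1_triple X T S R"
    unfolding F1_triple_def using mr T S sub by blast
  then show ?thesis by blast
qed

lemma num_max_F1:
  assumes fin: "finite X" and mr: "minimal_representation X R m l r" and F: "F1_triple X T S R"
  shows "num_max X S = card {c \<in> cell_of l r ` X. \<not> (\<exists>c' \<in> cell_of l r ` X. weakly_SW c c')}"
proof -
  obtain m' l' r' where mr': "minimal_representation X R m' l' r'"
    and dis: "\<And>x y. x \<in> X \<Longrightarrow> y \<in> X \<Longrightarrow> cell_of l' r' x \<noteq> cell_of l' r' y \<Longrightarrow>
       (x, y) \<in> S \<longleftrightarrow> weakly_SW (cell_of l' r' x) (cell_of l' r' y)"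
    and lin: "\<And>c. strict_linear_order_on (cell_elements X l' r' c) (Restr S (cell_elements X l' r' c))"
    using F unfolding F1_triple_def by blast
  define c where "c = cell_of l r"
  have c_eq: "cell_of l' r' x = c x" if "x \<in> X" for x
    using minimal_representation_unique[OF mr mr' that] by (simp add: c_def cell_of_def)
  have X_eq: "cell_elements X l' r' e = {x \<in> X. c x = e}" for e
    using c_eq by (auto simp: cell_elements_def)
  have dis: "(x, y) \<in> S \<longleftrightarrow> weakly_SW (c x) (c y)" if "x \<in> X" "y \<in> X" "c x \<noteq> c y" for x y
    using dis that c_eq by simp
  have irr: "(x, x) \<notin> S" if "x \<in> X" for x
    using lin[of "c x"] that unfolding X_eq strict_linear_order_on_def irrefl_def by auto
  have tra: "(x, z) \<in> S" if "(x, y) \<in> S" "(y, z) \<in> S" "x \<in> X" "y \<in> X" "z \<in> X" "c x = c y" "c y = c z" for x y z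
    using lin[of "c x"] that unfolding X_eq strict_linear_order_on_def trans_def by auto
  have tot: "(x, y) \<in> S \<or> (y, x) \<in> S" if "x \<in> X" "y \<in> X" "c x = c y" "x \<noteq> y" for x y
    using lin[of "c x"] that unfolding X_eq strict_linear_order_on_def total_on_def by auto
  have nw: "\<not> weakly_SW e e" for e
    by (auto simp: weakly_SW_def cell_South_def cell_West_def strictly_SW_def)
  let ?M = "{x \<in> X. \<not> (\<exists>y\<in>X. (x, y) \<in> S)}"
  let ?K = "{e \<in> c ` X. \<not> (\<exists>c' \<in> c ` X. weakly_SW e c')}"
  have "inj_on c ?M"
    by (rule inj_onI) (use tot in blast)
  moreover have "c ` ?M = ?K"
  proof
    show "c ` ?M \<subseteq> ?K"
    proof (rule image_subsetI)
      fix x assume x: "x \<in> ?M"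
      have "\<not> weakly_SW (c x) (c y)" if y: "y \<in> X" for y
      proof (cases "c x = c y")
        case True
        then show ?thesis using nw[of "c y"] by simp
      next
        case False
        then show ?thesis using dis[of x y] x y by blast
      qed
      then show "c x \<in> ?K" using x by blast
    qed
    show "?K \<subseteq> c ` ?M"
    proof
      fix e assume e: "e \<in> ?K"
      let ?Y = "{x \<in> X. c x = e}"
      let ?r = "Restr S ?Y"
      have "finite ?Y" "?Y \<noteq> {}" using fin e by auto
      moreover have "trans ?r" using tra by (intro transI) auto
      moreover have "irrefl ?r" using irr by (auto simp: irrefl_def)
      ultimately have "\<exists>x\<in>?Y. \<forall>y\<in>?Y. (x, y) \<notin> ?r"
      proof -
        assume f: "finite ?Y" and ne: "?Y \<noteq> {}" and t: "trans ?r" and i: "irrefl ?r"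
        have "acyclic ?r" using t i by (simp add: acyclic_irrefl)
        then have "wf (?r\<inverse>)" using f by (intro finite_acyclic_wf_converse) (auto intro: finite_subset[of _ "?Y \<times> ?Y"])
        then show ?thesis using ne by (metis (no_types, lifting) wfE_min' converse_iff)
      qed
      then obtain x where x: "x \<in> ?Y" "\<forall>y\<in>?Y. (x, y) \<notin> ?r" by blast
      have "(x, y) \<notin> S" if "y \<in> X" for y
        using x that dis[of x y] e by (cases "c y = e") auto
      then show "e \<in> c ` ?M" using x by auto
    qed
  qed
  ultimately have "card ?M = card ?K" using card_image by fastforce
  then show ?thesis by (simp add: num_max_def c_def)
qed

lemma num_max_F1_cong:
  assumes fin: "finite X" "finite Y" and iso: "poset_iso X R Y R' f"
    and F: "F1_triple X T S R" "F1_triple Y T' S' R'"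
  shows "num_max X S = num_max Y S'"
proof -
  obtain m l r where mr: "minimal_representation Y R' m l r"
    using F(2) unfolding F1_triple_def by blast
  have fX: "f ` X = Y" and rel: "\<And>x y. x \<in> X \<Longrightarrow> y \<in> X \<Longrightarrow> (x, y) \<in> R \<longleftrightarrow> (f x, f y) \<in> R'"
    using iso unfolding poset_iso_def bij_betw_def by auto
  have "minimal_representation X R m (l \<circ> f) (r \<circ> f)"
    using mr rel unfolding minimal_representation_def fX[symmetric] by (auto simp: image_image)
  from num_max_F1[OF fin(1) this F(1)] num_max_F1[OF fin(2) mr F(2)]
  show ?thesis by (simp add: fX[symmetric] image_image cell_of_def)
qed

lemma num_max_cong:
  assumes "poset_iso X R Y R' f"
  shows "num_max X R = num_max Y R'"
proof -
  have b: "bij_betw f X Y" and rel: "\<And>x y. x \<in> X \<Longrightarrow> y \<in> X \<Longrightarrow> (x, y) \<in> R \<longleftrightarrow> (f x, f y) \<in> R'"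
    using assms unfolding poset_iso_def by auto
  have fX: "f ` X = Y" using b by (auto simp: bij_betw_def)
  have "f ` {x \<in> X. \<not> (\<exists>y\<in>X. (x, y) \<in> R)} = {x \<in> Y. \<not> (\<exists>y\<in>Y. (x, y) \<in> R')}"
    using rel unfolding fX[symmetric] by auto
  moreover have "inj_on f {x \<in> X. \<not> (\<exists>y\<in>X. (x, y) \<in> R)}"
    using b by (auto simp: bij_betw_def intro: inj_on_subset)
  ultimately show ?thesis unfolding num_max_def using card_image by fastforce
qed

lemma equiv_isomorphic_orders:
  "equiv {R. interval_order_on {..<n} R} (isomorphic_orders n)"
proof (rule equivI)
  show "isomorphic_orders n \<subseteq> {R. interval_order_on {..<n} R} \<times> {R. interval_order_on {..<n} R}"
    by (auto simp: isomorphic_orders_def)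
  have "poset_iso {..<n} R {..<n} R id" for R
    by (simp add: poset_iso_def)
  then show "refl_on {R. interval_order_on {..<n} R} (isomorphic_orders n)"
    by (auto simp: refl_on_def isomorphic_orders_def)
  have "poset_iso {..<n} R' {..<n} R (inv_into {..<n} f)" if "poset_iso {..<n} R {..<n} R' f" for R R' f
  proof -
    let ?g = "inv_into {..<n} f"
    have b: "bij_betw f {..<n} {..<n}"
      and rel: "\<And>x y. x \<in> {..<n} \<Longrightarrow> y \<in> {..<n} \<Longrightarrow> (x, y) \<in> R \<longleftrightarrow> (f x, f y) \<in> R'"
      using that unfolding poset_iso_def by auto
    have g: "bij_betw ?g {..<n} {..<n}" using b by (rule bij_betw_inv_into)
    have "(x, y) \<in> R' \<longleftrightarrow> (?g x, ?g y) \<in> R" if xy: "x \<in> {..<n}" "y \<in> {..<n}" for x y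
    proof -
      have "?g x \<in> {..<n}" "?g y \<in> {..<n}" using g xy by (auto dest: bij_betwE)
      from rel[OF this] show ?thesis using b xy by (simp add: bij_betw_inv_into_right)
    qed
    then show ?thesis unfolding poset_iso_def using g by blast
  qed
  then show "sym (isomorphic_orders n)"
    by (auto simp: sym_def isomorphic_orders_def)
  have "poset_iso {..<n} R {..<n} R'' (g \<circ> f)"
    if "poset_iso {..<n} R {..<n} R' f" "poset_iso {..<n} R' {..<n} R'' g" for R R' R'' f g
    using that unfolding poset_iso_def by (auto intro: bij_betw_trans dest: bij_betwE)
  then show "trans (isomorphic_orders n)"
    by (auto simp: trans_def isomorphic_orders_def) blast
qed

lemma finite_interval_order_classes: "finite (interval_order_classes n)"
proof -
  have "{R. interval_order_on {..<n} R} \<subseteq> Pow ({..<n} \<times> {..<n})"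
    by (auto simp: interval_order_on_def)
  then have "finite {R. interval_order_on {..<n} R}" by (rule finite_subset) simp
  then show ?thesis
    unfolding interval_order_classes_def
    by (rule finite_quotient) (auto simp: isomorphic_orders_def)
qed

lemma interval_order_classes_iso:
  assumes "C \<in> interval_order_classes n" "R \<in> C" "R' \<in> C"
  shows "interval_order_on {..<n} R" "\<exists>f. poset_iso {..<n} R {..<n} R' f"
proof -
  have "(R, R') \<in> isomorphic_orders n"
    using assms quotient_eq_iff[OF equiv_isomorphic_orders] unfolding interval_order_classes_def by blast
  then show "interval_order_on {..<n} R" "\<exists>f. poset_iso {..<n} R {..<n} R' f"
    by (auto simp: isomorphic_orders_def)
qed

lemma max_R_class:
  assumes "C \<in> interval_order_classes n" "R \<in> C"
  shows "max_R n C = num_max {..<n} R"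
  unfolding max_R_def
proof (rule the_equality)
  fix k assume "\<exists>R\<in>C. num_max {..<n} R = k"
  then obtain R' where R': "R' \<in> C" "num_max {..<n} R' = k" by blast
  obtain f where "poset_iso {..<n} R {..<n} R' f"
    using interval_order_classes_iso(2)[OF assms R'(1)] by blast
  then show "k = num_max {..<n} R" using num_max_cong R'(2) by metis
qed (use assms in blast)

lemma max_S1_class:
  assumes "C \<in> interval_order_classes n" "R \<in> C" "F1_triple {..<n} T S R"
  shows "max_S1 n C = num_max {..<n} S"
  unfolding max_S1_def
proof (rule the_equality)
  fix k assume "\<exists>R\<in>C. \<exists>T S. F1_triple {..<n} T S R \<and> num_max {..<n} S = k"
  then obtain R' T' S' where "R' \<in> C" "F1_triple {..<n} T' S' R'" "num_max {..<n} S' = k" by blast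
  then show "k = num_max {..<n} S"
    using interval_order_classes_iso(2)[OF assms(1)] assms num_max_F1_cong[OF finite_lessThan finite_lessThan]
    by metis
qed (use assms in blast)

end

(* On the Fishburn matrix M of R, max(R) is the weight of the last column, and max(S_1) is the number ne(M)
   of nonzero cells with no other nonzero cell weakly to their north-east. Every Fishburn matrix of size m + 1
   arises uniquely from one of size m by splitting its last column into two columns, of which the left one is
   nonzero, and adding a positive corner entry; ne grows by one exactly when the topmost nonzero cell of the
   split column has no part in the new last column.
   Hence the generating function z H(z) of the supports, where x marks ne, each cell outside the last column
   contributes s = t/(1-t) and each cell of the last column contributes z, satisfies
     (1 + z) H(z) = x + (x s + z + s z) H(s + z + s z).
   Starting from z = y t/(1 - y t), the substitution multiplies 1 + z by 1/(1-t), and iteration yields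
     z H(z) = x y t (sum over k of the product over i < k of 1 - (1 - x t)(1 - y t)(1 - t)^i),
   which is symmetric in x and y. *)

theory Submission
  imports Defs "HOL-Computational_Algebra.Formal_Power_Series" "HOL-Computational_Algebra.Polynomial"
begin

section \<open>Supports of Fishburn matrices\<close>

text \<open>Only the positions of the nonzero entries are recorded. The count of north-east cells
  depends on nothing else, and the values of the entries are put back later by generating
  functions.\<close>

definition fishburn_support :: "nat \<Rightarrow> cell set \<Rightarrow> bool" where
  "fishburn_support m A \<longleftrightarrow> (\<forall>c\<in>A. fst c \<le> snd c) \<and> fst ` A = {1..m} \<and> snd ` A = {1..m}"

text \<open>These cells form a staircase along the north-east border; by \<open>num_max_F1\<close>
  they are counted by the statistic on \<open>S\<close>.\<close>

definition ne_cells :: "cell set \<Rightarrow> cell set" where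
  "ne_cells A = {c \<in> A. \<not> (\<exists>c'\<in>A. weakly_SW c c')}"

definition column :: "cell set \<Rightarrow> nat \<Rightarrow> nat set" where
  "column A j = {i. (i, j) \<in> A}"

lemma weakly_SW_iff: "weakly_SW c c' \<longleftrightarrow> fst c' \<le> fst c \<and> snd c \<le> snd c' \<and> c \<noteq> c'"
  by (cases c; cases c') (auto simp: weakly_SW_def cell_South_def cell_West_def strictly_SW_def)

lemma fishburn_supportD:
  assumes "fishburn_support m A" "(i, j) \<in> A"
  shows "1 \<le> i" "i \<le> j" "j \<le> m"
proof -
  have "i \<in> fst ` A" "j \<in> snd ` A" using assms(2) by force+
  then show "1 \<le> i" "i \<le> j" "j \<le> m" using assms unfolding fishburn_support_def by auto
qed

lemma fishburn_support_subset: "fishburn_support m A \<Longrightarrow> A \<subseteq> {1..m} \<times> {1..m}"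
proof
  fix c assume A: "fishburn_support m A" "c \<in> A"
  show "c \<in> {1..m} \<times> {1..m}" using fishburn_supportD[OF A(1), of "fst c" "snd c"] A(2) by (cases c) auto
qed

lemma finite_fishburn_support: "fishburn_support m A \<Longrightarrow> finite A"
  by (rule finite_subset[OF fishburn_support_subset]) simp_all

lemma finite_fishburn_supports: "finite {A. fishburn_support m A}"
proof -
  have "{A. fishburn_support m A} \<subseteq> Pow ({1..m} \<times> {1..m})"
    using fishburn_support_subset by blast
  then show ?thesis by (rule finite_subset) simp
qed

lemma fishburn_support_card_ge:
  assumes "fishburn_support m A"
  shows "m \<le> card A"
proof -
  have "card (fst ` A) \<le> card A" by (rule card_image_le) (rule finite_fishburn_support[OF assms])
  then show ?thesis using assms by (simp add: fishburn_support_def)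
qed

lemma fishburn_support_column:
  assumes "fishburn_support m A"
  shows "column A m \<subseteq> {1..m}" "finite (column A m)" "m \<noteq> 0 \<Longrightarrow> column A m \<noteq> {}"
proof -
  show sub: "column A m \<subseteq> {1..m}"
    using fishburn_supportD[OF assms] by (auto simp: column_def)
  show "finite (column A m)" using sub by (rule finite_subset) simp
  assume "m \<noteq> 0"
  then have "m \<in> snd ` A" using assms by (simp add: fishburn_support_def)
  then show "column A m \<noteq> {}" by (auto simp: column_def)
qed

lemma card_fishburn_support:
  assumes "fishburn_support m A"
  shows "card A = card {c \<in> A. snd c < m} + card (column A m)"
proof -
  have "A = {c \<in> A. snd c < m} \<union> (\<lambda>i. (i, m)) ` column A m"
    using fishburn_supportD[OF assms] by (force simp: column_def)
  moreover have "card ({c \<in> A. snd c < m} \<union> (\<lambda>i. (i, m)) ` column A m) =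
      card {c \<in> A. snd c < m} + card ((\<lambda>i. (i, m)) ` column A m)"
    using finite_fishburn_support[OF assms] fishburn_support_column[OF assms]
    by (intro card_Un_disjoint) auto
  ultimately show ?thesis by (simp add: card_image inj_on_def)
qed

lemma fishburn_support_one: "{A. fishburn_support 1 A} = {{(1, 1)}}"
proof -
  have "A = {(1, 1)}" if "fishburn_support 1 A" for A
  proof -
    have "A \<subseteq> {(1, 1)}" using fishburn_supportD[OF that] by force
    moreover have "A \<noteq> {}" using that by (auto simp: fishburn_support_def)
    ultimately show ?thesis by auto
  qed
  moreover have "fishburn_support 1 {(1, 1)}" by (auto simp: fishburn_support_def)
  ultimately show ?thesis by blast
qed

text \<open>The topmost cell of the last column dominates every other cell in or below its row,
  while a cell strictly above its row is dominated by no cell of the last column. So the staircase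
  of the earlier columns survives exactly above that row.\<close>

lemma ne_cells_last_column:
  assumes "\<And>c. c \<in> A \<Longrightarrow> snd c \<le> m" "finite (column A m)" "column A m \<noteq> {}"
  shows "ne_cells A = insert (Min (column A m), m)
    {c \<in> ne_cells {c \<in> A. snd c < m}. fst c < Min (column A m)}"
proof -
  define v where "v = Min (column A m)"
  have v: "(v, m) \<in> A" using Min_in[OF assms(2,3)] by (simp add: v_def column_def)
  have v_le: "v \<le> i" if "(i, m) \<in> A" for i
    using assms(2) that unfolding v_def by (intro Min_le) (auto simp: column_def)
  have top: "c = (v, m) \<or> (snd c < m \<and> fst c < v)" if c: "c \<in> ne_cells A" for c
  proof (rule ccontr)
    assume *: "\<not> ?thesis"
    have cA: "c \<in> A" and cn: "\<not> weakly_SW c (v, m)" using c v by (auto simp: ne_cells_def)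
    have le: "snd c \<le> m" using assms(1) cA by blast
    have "v \<le> fst c" if "snd c = m" using v_le[of "fst c"] cA that by (metis prod.collapse)
    with * cn le show False by (auto simp: weakly_SW_iff)
  qed
  have vne: "(v, m) \<in> ne_cells A"
    using v v_le assms(1) by (force simp: ne_cells_def weakly_SW_iff)
  have lower: "c \<in> ne_cells A \<longleftrightarrow> c \<in> ne_cells {c \<in> A. snd c < m}" if "fst c < v" "snd c < m" for c
  proof -
    have "snd c' < m" if c': "c' \<in> A" "weakly_SW c c'" for c'
    proof (rule ccontr)
      assume "\<not> snd c' < m"
      then have "snd c' = m" using assms(1)[OF c'(1)] by simp
      then have "v \<le> fst c'" using v_le[of "fst c'"] c'(1) by (metis prod.collapse)
      then show False using c'(2) \<open>fst c < v\<close> by (simp add: weakly_SW_iff)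
    qed
    then show ?thesis using that unfolding ne_cells_def by blast
  qed
  have lt: "snd c < m" if "c \<in> ne_cells {c \<in> A. snd c < m}" for c
    using that by (simp add: ne_cells_def)
  show ?thesis unfolding v_def[symmetric] using top vne lower lt by blast
qed

text \<open>\<open>U\<close> and \<open>W\<close> are the row sets of the two columns that replace
  column \<open>m\<close>. They may overlap, since a positive entry can split into two positive
  parts. \<open>Suc m\<close> is the row of the added corner entry.\<close>

definition split_column :: "nat \<Rightarrow> cell set \<Rightarrow> nat set \<Rightarrow> nat set \<Rightarrow> cell set" where
  "split_column m A U W =
     {c \<in> A. snd c < m} \<union> U \<times> {m} \<union> insert (Suc m) W \<times> {Suc m}"

lemma split_column_columns:
  shows "{c \<in> split_column m A U W. snd c < m} = {c \<in> A. snd c < m}"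
    and "{c \<in> split_column m A U W. snd c < Suc m} = {c \<in> A. snd c < m} \<union> U \<times> {m}"
    and "column (split_column m A U W) m = U"
    and "column (split_column m A U W) (Suc m) = insert (Suc m) W"
  by (auto simp: split_column_def column_def)

text \<open>The columns left of \<open>m\<close> are unchanged, so only the top cells of the two new
  columns matter. If the old top row occurs in \<open>W\<close>, the top cell of column
  \<open>Suc m\<close> replaces the old one. Otherwise the old top cell stays in column
  \<open>m\<close>, and the top cell of column \<open>Suc m\<close>, which lies lower, is counted in
  addition.\<close>

lemma card_ne_cells_split_column:
  assumes A: "fishburn_support m A" and UW: "U \<union> W = column A m" "U \<noteq> {}"
  shows "card (ne_cells (split_column m A U W)) =
    card (ne_cells A) + (if Min (column A m) \<in> W then 0 else 1)"
proof -
  let ?B = "{c \<in> A. snd c < m}"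
  define V where "V = column A m"
  note V = fishburn_support_column[OF A, folded V_def]
  have fin: "finite U" "finite W" and Vne: "V \<noteq> {}"
    using V(2) UW unfolding V_def[symmetric] by auto
  define u where "u = Min U"
  \<comment> \<open>The corner row \<open>Suc m\<close> belongs to the new last column, so the
    minimum exists even if \<open>W\<close> is empty.\<close>
  define w where "w = Min (insert (Suc m) W)"
  define v where "v = Min V"
  have u: "u \<in> U" "\<And>i. i \<in> U \<Longrightarrow> u \<le> i" using fin UW(2) by (auto simp: u_def)
  have w: "w \<in> insert (Suc m) W" "\<And>i. i \<in> insert (Suc m) W \<Longrightarrow> w \<le> i"
    using fin Min_in[of "insert (Suc m) W"] unfolding w_def by auto
  have v: "v \<in> U \<union> W" "\<And>i. i \<in> U \<union> W \<Longrightarrow> v \<le> i"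
    using V(2) Vne UW(1) unfolding v_def V_def by auto
  have m: "i \<le> m" if "i \<in> U \<union> W" for i using that V(1) UW(1) V_def by auto
  have finB: "finite (ne_cells ?B)"
    using finite_fishburn_support[OF A] by (simp add: ne_cells_def)
  \<comment> \<open>The description of the last column is used three times: for \<open>A\<close>,
    for the split support, and for the split support without its last column.\<close>
  have A1: "ne_cells A = insert (v, m) {c \<in> ne_cells ?B. fst c < v}"
    unfolding v_def V_def using A V Vne fishburn_supportD(3)[OF A]
    by (intro ne_cells_last_column) (auto simp: V_def)
  have S1: "ne_cells (split_column m A U W) =
      insert (w, Suc m) {c \<in> ne_cells (?B \<union> U \<times> {m}). fst c < w}"
    using ne_cells_last_column[of "split_column m A U W" "Suc m", unfolded split_column_columns, folded w_def] fin
    by (simp add: split_column_def) fastforce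
  have col: "column (?B \<union> U \<times> {m}) m = U" by (auto simp: column_def)
  have less: "{c \<in> ?B \<union> U \<times> {m}. snd c < m} = ?B" by auto
  have "\<And>c. c \<in> ?B \<union> U \<times> {m} \<Longrightarrow> snd c \<le> m" by auto
  from ne_cells_last_column[of "?B \<union> U \<times> {m}" m, unfolded col less, folded u_def, OF this fin(1) UW(2)]
  have S2: "ne_cells (?B \<union> U \<times> {m}) = insert (u, m) {c \<in> ne_cells ?B. fst c < u}"
    by simp
  have notin: "(i, m) \<notin> ne_cells ?B" "(i, Suc m) \<notin> ne_cells ?B" for i by (auto simp: ne_cells_def)
  show ?thesis
  proof (cases "v \<in> W")
    case True
    then have "w = v" using w v m by (metis UnCI insert_iff le_antisym not_less_eq_eq)
    moreover have "v \<le> u" using u v by blast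
    ultimately have "ne_cells (split_column m A U W) = insert (v, Suc m) {c \<in> ne_cells ?B. fst c < v}"
      unfolding S1 S2 by auto
    then show ?thesis using True finB notin unfolding A1 by (simp add: v_def V_def)
  next
    case False
    then have "v \<in> U" using v by blast
    then have "u = v" using u v by (simp add: le_antisym)
    moreover have "v < w" using w v m[OF v(1)] False by (metis UnCI insert_iff le_imp_less_Suc le_neq_implies_less)
    ultimately have "ne_cells (split_column m A U W) =
        insert (w, Suc m) (insert (v, m) {c \<in> ne_cells ?B. fst c < v})"
      unfolding S1 S2 by auto
    then show ?thesis using False finB notin unfolding A1 by (simp add: v_def V_def)
  qed
qed

text \<open>Each element of \<open>V\<close> chooses independently to lie in \<open>U\<close> only,
  in \<open>W\<close> only or in both, so the sum factors. The weight may depend on the element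
  because the top cell of a column needs a weight of its own.\<close>

lemma sum_covering_pairs:
  fixes g :: "'a \<Rightarrow> bool \<Rightarrow> bool \<Rightarrow> 'b::comm_semiring_1"
  assumes "finite V"
  shows "(\<Sum>(U, W) | U \<union> W = V. \<Prod>i\<in>V. g i (i \<in> U) (i \<in> W)) =
    (\<Prod>i\<in>V. g i True False + g i False True + g i True True)"
  using assms
proof (induction V)
  case empty
  have "{(U, W). U \<union> W = {}} = {({}, {} :: 'a set)}" by auto
  then show ?case by simp
next
  case (insert a V)
  let ?P = "\<lambda>V. {(U, W). U \<union> W = V}"
  let ?h = "\<lambda>V (U, W). \<Prod>i\<in>V. g i (i \<in> U) (i \<in> W)"
  \<comment> \<open>\<open>e p q\<close> inserts \<open>a\<close> into the first set if
    \<open>p\<close> and into the second if \<open>q\<close>. The three choices other than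
    \<open>False False\<close> partition the pairs covering \<open>insert a V\<close>.\<close>
  define e where "e p q = (\<lambda>(U, W). (if p then insert a U else U, if q then insert a W else W))" for p q
  have fin: "finite (?P V)"
    using insert.hyps(1) by (auto intro: finite_subset[of _ "Pow V \<times> Pow V"])
  have inj: "inj_on (e p q) (?P V)" for p q
    using insert.hyps(2) by (auto simp: inj_on_def e_def split: if_splits)
  have S: "(\<Sum>UW \<in> e p q ` ?P V. ?h (insert a V) UW) = g a p q * (\<Sum>UW \<in> ?P V. ?h V UW)" for p q
  proof -
    have h: "?h (insert a V) (e p q UW) = g a p q * ?h V UW" if UW: "UW \<in> ?P V" for UW
    proof -
      obtain U W where UW: "UW = (U, W)" "U \<union> W = V" using UW by (cases UW) auto
      have "(\<Prod>i\<in>V. g i (i \<in> fst (e p q UW)) (i \<in> snd (e p q UW))) = (\<Prod>i\<in>V. g i (i \<in> U) (i \<in> W))"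
      proof (rule prod.cong[OF refl])
        fix i assume "i \<in> V"
        then have "i \<noteq> a" using insert.hyps(2) by auto
        then show "g i (i \<in> fst (e p q UW)) (i \<in> snd (e p q UW)) = g i (i \<in> U) (i \<in> W)"
          by (simp add: UW e_def)
      qed
      moreover have "a \<notin> U" "a \<notin> W" using insert.hyps(2) UW by auto
      ultimately show ?thesis using insert.hyps by (auto simp: UW e_def)
    qed
    show ?thesis
      unfolding sum.reindex[OF inj] comp_def sum_distrib_left by (rule sum.cong[OF refl]) (rule h)
  qed
  have P: "?P (insert a V) = e True False ` ?P V \<union> e False True ` ?P V \<union> e True True ` ?P V"
    (is "_ = ?r")
  proof
    show "?P (insert a V) \<subseteq> ?r"
    proof (safe)
      fix U W assume UW: "U \<union> W = insert a V" "(U, W) \<notin> e True True ` ?P V" "(U, W) \<notin> e False True ` ?P V"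
      have V: "(U - {a}, W - {a}) \<in> ?P V" using UW insert.hyps(2) by auto
      have *: "(U, W) = e (a \<in> U) (a \<in> W) (U - {a}, W - {a})" by (auto simp: e_def)
      have "a \<in> U \<or> a \<in> W" using UW(1) by auto
      moreover have "(U, W) \<in> e (a \<in> U) (a \<in> W) ` ?P V"
        using imageI[OF V, of "e (a \<in> U) (a \<in> W)"] unfolding *[symmetric] .
      ultimately show "(U, W) \<in> e True False ` ?P V"
        using UW(2,3) by (cases "a \<in> U"; cases "a \<in> W") simp_all
    qed
    show "?r \<subseteq> ?P (insert a V)" by (auto simp: e_def)
  qed
  have disj: "e p q ` ?P V \<inter> e p' q' ` ?P V = {}" if "(p, q) \<noteq> (p', q')" for p q p' q'
  proof -
    have mem: "a \<in> fst UW \<longleftrightarrow> p" "a \<in> snd UW \<longleftrightarrow> q" if "UW \<in> e p q ` ?P V" for UW p q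
      using that insert.hyps(2) by (auto simp: e_def)
    show ?thesis
    proof (rule equals0I)
      fix UW assume "UW \<in> e p q ` ?P V \<inter> e p' q' ` ?P V"
      then have "p = p'" "q = q'" using mem[of UW p q] mem[of UW p' q'] by simp_all
      then show False using that by simp
    qed
  qed
  have union: "sum k (A \<union> B \<union> C) = sum k A + sum k B + sum k C"
    if "finite A" "finite B" "finite C" "A \<inter> B = {}" "A \<inter> C = {}" "B \<inter> C = {}"
    for k :: "'a set \<times> 'a set \<Rightarrow> 'b" and A B C
    using that by (simp add: sum.union_disjoint Int_Un_distrib2)
  have "(\<Sum>UW \<in> ?P (insert a V). ?h (insert a V) UW) =
      (\<Sum>UW \<in> e True False ` ?P V. ?h (insert a V) UW) + (\<Sum>UW \<in> e False True ` ?P V. ?h (insert a V) UW)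
      + (\<Sum>UW \<in> e True True ` ?P V. ?h (insert a V) UW)"
    unfolding P using fin by (intro union finite_imageI disj) simp_all
  then show ?case unfolding S insert.IH by (simp add: insert.hyps distrib_right)
qed

section \<open>Generating functions of supports\<close>

text \<open>The generating function of the supports of size \<open>m\<close>, divided by \<open>z\<close>: the last column always
  contains the corner cell, so the truncated subtraction is harmless for \<open>m > 0\<close>.\<close>

definition support_gf :: "'a::comm_ring_1 \<Rightarrow> 'a \<Rightarrow> nat \<Rightarrow> 'a \<Rightarrow> 'a" where
  "support_gf x s m z = (\<Sum>A | fishburn_support m A.
     x ^ card (ne_cells A) * s ^ card {c \<in> A. snd c < m} * z ^ (card (column A m) - 1))"

lemma support_gf_one: "support_gf x s 1 z = x"
proof -
  have "ne_cells {(1, 1)} = {(1, 1)}" by (auto simp: ne_cells_def weakly_SW_iff)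
  moreover have "column {(1, 1)} 1 = {1}" by (auto simp: column_def)
  moreover have "{c \<in> {(1, 1)}. snd c < (1::nat)} = ({} :: cell set)" by auto
  moreover have "support_gf x s 1 z = x ^ card (ne_cells {(1, 1)}) *
      s ^ card {c \<in> {(1, 1) :: cell}. snd c < 1} * z ^ (card (column {(1, 1)} 1) - 1)"
    unfolding support_gf_def fishburn_support_one by simp
  ultimately show ?thesis by (simp only:) simp
qed

section \<open>Recursion in the size of the support\<close>

lemma fishburn_support_split_column:
  assumes "fishburn_support m A" "U \<union> W = column A m" "U \<noteq> {}" "m \<noteq> 0"
  shows "fishburn_support (Suc m) (split_column m A U W)"
proof -
  let ?A' = "split_column m A U W"
  have fA: "fst ` A = {1..m}" and sA: "snd ` A = {1..m}" and le: "\<And>c. c \<in> A \<Longrightarrow> fst c \<le> snd c"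
    using assms(1) by (auto simp: fishburn_support_def)
  have UW: "U \<subseteq> {1..m}" "W \<subseteq> {1..m}" using fishburn_support_column(1)[OF assms(1)] assms(2) by auto
  have "fst c \<le> snd c" if "c \<in> ?A'" for c using that le UW by (auto simp: split_column_def)
  moreover have "fst ` ?A' = {1..Suc m}"
  proof
    show "fst ` ?A' \<subseteq> {1..Suc m}"
    proof (rule image_subsetI)
      fix c assume "c \<in> ?A'"
      then show "fst c \<in> {1..Suc m}"
        using UW fishburn_supportD[OF assms(1), of "fst c" "snd c"] by (auto simp: split_column_def)
    qed
    show "{1..Suc m} \<subseteq> fst ` ?A'"
    proof
      fix i assume i: "i \<in> {1..Suc m}"
      show "i \<in> fst ` ?A'"
      proof (cases "i = Suc m")
        case True
        then show ?thesis by (force simp: split_column_def)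
      next
        case False
        then have "i \<in> fst ` A" using i fA by simp
        then obtain j where j: "(i, j) \<in> A" by auto
        show ?thesis
        proof (cases "j < m")
          case True
          then have "(i, j) \<in> ?A'" using j by (simp add: split_column_def)
          then show ?thesis by force
        next
          case False
          then have "j = m" using fishburn_supportD(3)[OF assms(1) j] by simp
          \<comment> \<open>The two new columns together contain every row of the old last column,
            so no row becomes empty.\<close>
          then have "i \<in> U \<union> W" using j assms(2) by (simp add: column_def)
          then have "(i, m) \<in> ?A' \<or> (i, Suc m) \<in> ?A'" by (auto simp: split_column_def)
          then show ?thesis by force
        qed
      qed
    qed
  qed
  moreover have "snd ` ?A' = {1..Suc m}"
  proof
    show "snd ` ?A' \<subseteq> {1..Suc m}"
    proof (rule image_subsetI)
      fix c assume "c \<in> ?A'"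
      then show "snd c \<in> {1..Suc m}"
        using fishburn_supportD[OF assms(1), of "fst c" "snd c"] assms(4) by (auto simp: split_column_def)
    qed
    show "{1..Suc m} \<subseteq> snd ` ?A'"
    proof
      fix j assume j: "j \<in> {1..Suc m}"
      consider "j < m" | "j = m" | "j = Suc m" using j by force
      then show "j \<in> snd ` ?A'"
      proof cases
        case 1
        then have "j \<in> snd ` A" using j sA by simp
        then obtain i where "(i, j) \<in> A" by auto
        then have "(i, j) \<in> ?A'" using 1 by (simp add: split_column_def)
        then show ?thesis by force
      next
        case 2
        obtain i where "i \<in> U" using assms(3) by blast
        then have "(i, j) \<in> ?A'" using 2 by (simp add: split_column_def)
        then show ?thesis by force
      next
        case 3
        then show ?thesis by (force simp: split_column_def)
      qed
    qed
  qed
  ultimately show ?thesis by (simp add: fishburn_support_def)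
qed

text \<open>Inverse to \<open>split_column\<close>; the corner goes because row \<open>Suc m\<close>
  disappears.\<close>

definition merge_columns :: "nat \<Rightarrow> cell set \<Rightarrow> cell set" where
  "merge_columns m A = {c \<in> A. snd c < m} \<union> (column A m \<union> (column A (Suc m) - {Suc m})) \<times> {m}"

text \<open>In an upper triangular support the last row can contain only the corner, and it is not
  empty. Hence the corner is present, and without it only rows up to \<open>m\<close> occur, so the
  merged support is again upper triangular.\<close>

lemma fishburn_support_merge_columns:
  assumes A: "fishburn_support (Suc m) A" and m: "m \<noteq> 0"
  shows "fishburn_support m (merge_columns m A)" "column A m \<noteq> {}"
    "split_column m (merge_columns m A) (column A m) (column A (Suc m) - {Suc m}) = A"
proof -
  let ?A' = "merge_columns m A"
  note D = fishburn_supportD[OF A]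
  have fA: "fst ` A = {1..Suc m}" and sA: "snd ` A = {1..Suc m}"
    using A by (auto simp: fishburn_support_def)
  have corner: "(Suc m, Suc m) \<in> A"
  proof -
    have "Suc m \<in> fst ` A" unfolding fA by simp
    then obtain j where j: "(Suc m, j) \<in> A" by auto
    then show ?thesis using D(2,3)[OF j] by simp
  qed
  have "m \<in> snd ` A" unfolding sA using m by simp
  then show ne: "column A m \<noteq> {}" by (auto simp: column_def)
  have row: "i \<le> m" if "(i, j) \<in> A" "(i, j) \<noteq> (Suc m, Suc m)" for i j
    using D[OF that(1)] that(2) by (cases "i = Suc m") auto
  have le: "fst c \<le> snd c" if "c \<in> ?A'" for c
  proof -
    have "i \<le> m" if "(i, Suc m) \<in> A" "i \<noteq> Suc m" for i using row[OF that(1)] that(2) by simp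
    then show ?thesis using that D(2) unfolding merge_columns_def column_def by fastforce
  qed
  have "fst ` ?A' = {1..m}"
  proof
    show "fst ` ?A' \<subseteq> {1..m}"
      using D row by (fastforce simp: merge_columns_def column_def)
    show "{1..m} \<subseteq> fst ` ?A'"
    proof
      fix i assume i: "i \<in> {1..m}"
      then have "i \<in> fst ` A" using fA by simp
      then obtain j where j: "(i, j) \<in> A" by auto
      then have "(i, j) \<in> ?A' \<or> (i, m) \<in> ?A'"
        using D(3)[OF j] i by (cases "j < m"; cases "j = m") (auto simp: merge_columns_def column_def le_Suc_eq)
      then show "i \<in> fst ` ?A'" by force
    qed
  qed
  moreover have "snd ` ?A' = {1..m}"
  proof
    show "snd ` ?A' \<subseteq> {1..m}"
      using D m by (force simp: merge_columns_def column_def)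
    show "{1..m} \<subseteq> snd ` ?A'"
    proof
      fix j assume j: "j \<in> {1..m}"
      then have "j \<in> snd ` A" using sA by simp
      then obtain i where "(i, j) \<in> A" by auto
      then have "(i, j) \<in> ?A'" using j by (cases "j = m") (auto simp: merge_columns_def column_def)
      then show "j \<in> snd ` ?A'" by force
    qed
  qed
  ultimately show "fishburn_support m ?A'" using le by (simp add: fishburn_support_def)
  have "snd c < m \<or> snd c = m \<or> snd c = Suc m" if "c \<in> A" for c
    using D(3)[of "fst c" "snd c"] that by auto
  then show "split_column m ?A' (column A m) (column A (Suc m) - {Suc m}) = A"
    by (intro set_eqI) (use corner in \<open>force simp: split_column_def merge_columns_def column_def\<close>)
qed

lemma merge_split_column:
  assumes "fishburn_support m A" "U \<union> W = column A m"
  shows "merge_columns m (split_column m A U W) = A"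
proof -
  have "Suc m \<notin> W" using fishburn_support_column(1)[OF assms(1)] assms(2) by auto
  then have "merge_columns m (split_column m A U W) = {c \<in> A. snd c < m} \<union> column A m \<times> {m}"
    unfolding merge_columns_def split_column_columns assms(2)[symmetric] by auto
  moreover have "snd c < m \<or> snd c = m" if "c \<in> A" for c
    using fishburn_supportD(3)[OF assms(1), of "fst c" "snd c"] that by auto
  then have "c \<in> {c \<in> A. snd c < m} \<union> column A m \<times> {m} \<longleftrightarrow> c \<in> A" for c
    by (cases c) (fastforce simp: column_def)
  ultimately show ?thesis by blast
qed

text \<open>A cell of the old last column contributes \<open>s\<close> if it goes to the left column
  only, \<open>z\<close> if to the right only, and \<open>s * z\<close> if to both; this gives the
  substituted argument. By \<open>card_ne_cells_split_column\<close> the top cell gains a factor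
  \<open>x\<close> when it goes to the left only. The subtracted term removes the choice of an empty
  left column.\<close>

lemma support_gf_Suc:
  fixes x s z :: "'a::comm_ring_1"
  assumes m: "m \<noteq> 0"
  shows "support_gf x s (Suc m) z =
    (x * s + z + s * z) * support_gf x s m (s + z + s * z) - z * support_gf x s m z"
proof -
  let ?\<phi> = "s + z + s * z"
  define P where "P A = {(U, W). U \<union> W = column A m \<and> U \<noteq> {}}" for A
  \<comment> \<open>The new corner carries no weight here, which matches the division by
    \<open>z\<close> in \<open>support_gf\<close>.\<close>
  define wt where "wt = (\<lambda>(A, U :: nat set, W). x ^ card (ne_cells A) * s ^ card {c \<in> A. snd c < m} *
      (s ^ card U * z ^ card W * (if Min (column A m) \<in> W then 1 else x)))"
  have finP: "finite (P A)" if "fishburn_support m A" for A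
    using fishburn_support_column(2)[OF that]
    by (auto simp: P_def intro: finite_subset[of _ "Pow (column A m) \<times> Pow (column A m)"])
  have "support_gf x s (Suc m) z = (\<Sum>AUW\<in>(SIGMA A:{A. fishburn_support m A}. P A). wt AUW)"
    unfolding support_gf_def
  proof (rule sum.reindex_bij_witness[where
      i = "\<lambda>(A, U, W). split_column m A U W" and
      j = "\<lambda>A. (merge_columns m A, column A m, column A (Suc m) - {Suc m})"], goal_cases)
    case (1 A)
    then show ?case using fishburn_support_merge_columns(3)[OF _ m] by auto
  next
    case (2 A)
    then have A: "fishburn_support (Suc m) A" by simp
    have "column (merge_columns m A) m = column A m \<union> (column A (Suc m) - {Suc m})"
      by (auto simp: merge_columns_def column_def)
    then show ?case using fishburn_support_merge_columns[OF A m] by (auto simp: P_def)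
  next
    case (3 AUW)
    then obtain A U W where AUW: "AUW = (A, U, W)" "fishburn_support m A" "U \<union> W = column A m" by (auto simp: P_def)
    have "Suc m \<notin> W" using fishburn_support_column(1)[OF AUW(2)] AUW(3) by auto
    then show ?case using merge_split_column AUW by (simp add: split_column_columns)
  next
    case (4 AUW)
    then show ?case using fishburn_support_split_column[OF _ _ _ m] by (auto simp: P_def)
  next
    case (5 A')
    then have A': "fishburn_support (Suc m) A'" by simp
    define A U W where "A = merge_columns m A'" and "U = column A' m" and "W = column A' (Suc m) - {Suc m}"
    have A: "fishburn_support m A" and U: "U \<noteq> {}" and eq: "A' = split_column m A U W"
      using fishburn_support_merge_columns[OF A' m] by (auto simp: A_def U_def W_def)
    have V: "U \<union> W = column A m" by (auto simp: A_def U_def W_def merge_columns_def column_def)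
    have fin: "finite U" "finite W" using fishburn_support_column(2)[OF A] V by (metis finite_Un)+
    have W: "Suc m \<notin> W" by (simp add: W_def)
    have "card {c \<in> A'. snd c < Suc m} = card {c \<in> A. snd c < m} + card U"
    proof -
      have "card ({c \<in> A. snd c < m} \<union> U \<times> {m}) = card {c \<in> A. snd c < m} + card (U \<times> {m})"
        using fin finite_fishburn_support[OF A] by (intro card_Un_disjoint) auto
      then show ?thesis by (simp add: eq split_column_columns card_cartesian_product)
    qed
    moreover have "card (column A' (Suc m)) - 1 = card W"
      using W fin by (simp add: eq split_column_columns)
    ultimately show ?case
      unfolding A_def[symmetric] U_def[symmetric] W_def[symmetric]
      using card_ne_cells_split_column[OF A V U] by (simp add: wt_def eq power_add)
  qed
  also have "\<dots> = (\<Sum>A | fishburn_support m A. \<Sum>UW\<in>P A. wt (A, UW))"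
    using finP finite_fishburn_supports by (subst sum.Sigma) auto
  also have "\<dots> = (\<Sum>A | fishburn_support m A. x ^ card (ne_cells A) * s ^ card {c \<in> A. snd c < m} *
      ((x * s + z + s * z) * ?\<phi> ^ (card (column A m) - 1) - z * z ^ (card (column A m) - 1)))"
  proof (rule sum.cong[OF refl])
    fix A assume "A \<in> {A. fishburn_support m A}"
    then have A: "fishburn_support m A" by simp
    define V where "V = column A m"
    note V = fishburn_support_column[OF A, folded V_def]
    define v where "v = Min V"
    have v: "v \<in> V" using V m by (simp add: v_def)
    \<comment> \<open>The dependence on the top row \<open>v\<close> is put into the factor at
      \<open>v\<close>, so that the weight becomes a product over the column.\<close>
    define g where "g i p q = (if p then s else 1) * (if q then z else 1) * (if i = v \<and> \<not> q then x else 1)" for i p q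
    let ?Q = "{(U, W). U \<union> W = V}"
    have g: "(\<Prod>i\<in>V. g i (i \<in> U) (i \<in> W)) = s ^ card U * z ^ card W * (if v \<in> W then 1 else x)"
      if "U \<union> W = V" for U W
    proof -
      have *: "(\<Prod>i\<in>V. if i \<in> Y then b else 1) = b ^ card Y" if "Y \<subseteq> V" for Y and b :: 'a
        using that V(2) by (simp add: prod.inter_restrict[symmetric] Int_absorb1)
      have "(\<Prod>i\<in>V. if i = v \<and> i \<notin> W then x else 1) = (\<Prod>i\<in>V. if i = v then (if v \<in> W then 1 else x) else 1)"
        by (intro prod.cong) auto
      also have "\<dots> = (if v \<in> W then 1 else x)" using V(2) v by simp
      finally have **: "(\<Prod>i\<in>V. if i = v \<and> i \<notin> W then x else 1) = (if v \<in> W then 1 else x)" .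
      have "U \<subseteq> V" "W \<subseteq> V" using that by auto
      from *[OF this(1)] *[OF this(2)] show ?thesis by (simp only: g_def prod.distrib **)
    qed
    have finQ: "finite ?Q" using V(2) by (auto intro: finite_subset[of _ "Pow V \<times> Pow V"])
    have "(\<Prod>i\<in>V. g i True False + g i False True + g i True True) =
        (x * s + z + s * z) * (\<Prod>i\<in>V - {v}. ?\<phi>)"
    proof -
      have "(\<Prod>i\<in>V - {v}. g i True False + g i False True + g i True True) = (\<Prod>i\<in>V - {v}. ?\<phi>)"
        by (rule prod.cong) (auto simp: g_def)
      then show ?thesis
        unfolding prod.remove[OF V(2) v] by (simp add: g_def mult.commute)
    qed
    then have "(\<Sum>(U, W)\<in>?Q. s ^ card U * z ^ card W * (if v \<in> W then 1 else x)) =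
        (x * s + z + s * z) * ?\<phi> ^ (card V - 1)"
    proof -
      have "(\<Sum>(U, W)\<in>?Q. s ^ card U * z ^ card W * (if v \<in> W then 1 else x)) =
          (\<Sum>(U, W)\<in>?Q. \<Prod>i\<in>V. g i (i \<in> U) (i \<in> W))"
        using g by (intro sum.cong refl) (simp add: split_def)
      then show ?thesis
        using \<open>_ = (x * s + z + s * z) * (\<Prod>i\<in>V - {v}. ?\<phi>)\<close> sum_covering_pairs[OF V(2), of g] v
        by simp
    qed
    \<comment> \<open>The only covering pair with empty left part is \<open>({}, V)\<close>; its
      weight is \<open>z ^ card V\<close>.\<close>
    moreover have "?Q = insert ({}, V) (P A)" "({}, V) \<notin> P A"
      by (auto simp: P_def V_def)
    ultimately have "(\<Sum>(U, W)\<in>P A. s ^ card U * z ^ card W * (if v \<in> W then 1 else x)) + z ^ card V =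
        (x * s + z + s * z) * ?\<phi> ^ (card V - 1)"
      using finP[OF A] v by (simp add: add.commute)
    moreover have "z ^ card V = z * z ^ (card V - 1)"
      using V m by (simp add: card_gt_0_iff power_eq_if)
    ultimately have *: "(\<Sum>(U, W)\<in>P A. s ^ card U * z ^ card W * (if v \<in> W then 1 else x)) =
        (x * s + z + s * z) * ?\<phi> ^ (card V - 1) - z * z ^ (card V - 1)"
      by (simp add: eq_diff_eq)
    show "(\<Sum>UW\<in>P A. wt (A, UW)) = x ^ card (ne_cells A) * s ^ card {c \<in> A. snd c < m} *
      ((x * s + z + s * z) * ?\<phi> ^ (card (column A m) - 1) - z * z ^ (card (column A m) - 1))"
      unfolding V_def[symmetric] *[symmetric]
      by (simp add: wt_def sum_distrib_left split_def V_def v_def)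
  qed
  also have "\<dots> = (x * s + z + s * z) * support_gf x s m ?\<phi> - z * support_gf x s m z"
    by (simp add: support_gf_def sum_distrib_left sum_subtractf algebra_simps)
  finally show ?thesis .
qed

text \<open>A support of size \<open>m\<close> has at least \<open>m\<close> cells, and all but at
  most one of them contribute a factor divisible by \<open>t\<close>. So large sizes are negligible
  modulo powers of \<open>t\<close>.\<close>

lemma support_gf_dvd:
  fixes x s z t :: "'a::comm_ring_1"
  assumes "t dvd s" "t dvd z"
  shows "t ^ (m - 1) dvd support_gf x s m z"
  unfolding support_gf_def
proof (rule dvd_sum)
  fix A assume "A \<in> {A. fishburn_support m A}"
  then have A: "fishburn_support m A" by simp
  let ?a = "card {c \<in> A. snd c < m}" and ?b = "card (column A m) - 1"
  have "m - 1 \<le> ?a + ?b"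
    using fishburn_support_card_ge[OF A] card_fishburn_support[OF A] by linarith
  then have "t ^ (m - 1) dvd t ^ (?a + ?b)" by (rule le_imp_power_dvd)
  also have "t ^ (?a + ?b) dvd s ^ ?a * z ^ ?b"
    unfolding power_add using assms by (intro mult_dvd_mono dvd_power_same)
  finally show "t ^ (m - 1) dvd x ^ card (ne_cells A) * s ^ ?a * z ^ ?b"
    by (simp add: mult.assoc)
qed

section \<open>Symmetry of the generating function\<close>

text \<open>After \<open>N\<close> iterations the remainder contains the product of \<open>N\<close>
  factors \<open>f i\<close>, each divisible by \<open>t\<close>. Working modulo
  \<open>t ^ N\<close> lets finite sums stand in for the infinite one.\<close>

lemma unroll_recursion_mod_power:
  fixes t a :: "'a::comm_ring_1"
  assumes rec: "\<And>i. t ^ N dvd T i - (a + f i * T (Suc i))" and f: "\<And>i. t dvd f i"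
  shows "t ^ N dvd T 0 - a * (\<Sum>k<N. \<Prod>i<k. f i)"
proof -
  have *: "t ^ N dvd T 0 - (a * (\<Sum>k<K. \<Prod>i<k. f i) + (\<Prod>i<K. f i) * T K)" for K
  proof (induction K)
    case (Suc K)
    have "t ^ N dvd (T 0 - (a * (\<Sum>k<K. \<Prod>i<k. f i) + (\<Prod>i<K. f i) * T K))
        + (\<Prod>i<K. f i) * (T K - (a + f K * T (Suc K)))"
      using Suc rec[of K] by (intro dvd_add dvd_mult)
    also have "\<dots> = T 0 - (a * (\<Sum>k<Suc K. \<Prod>i<k. f i) + (\<Prod>i<Suc K. f i) * T (Suc K))"
      by (simp add: algebra_simps)
    finally show ?case .
  qed simp
  have "t ^ K dvd (\<Prod>i<K. f i)" for K
    by (induction K) (use f in \<open>auto simp: mult.commute[of t] intro: mult_dvd_mono\<close>)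
  then have "t ^ N dvd (T 0 - (a * (\<Sum>k<N. \<Prod>i<k. f i) + (\<Prod>i<N. f i) * T N)) + (\<Prod>i<N. f i) * T N"
    using *[of N] by (intro dvd_add dvd_mult2)
  then show ?thesis by (simp add: algebra_simps)
qed

text \<open>The series \<open>y t + y\<^sup>2 t\<^sup>2 + \<dots>\<close> enumerates the possible values of a nonzero entry
  whose units carry weight \<open>y\<close>.\<close>

definition geom :: "real \<Rightarrow> real fps" where
  "geom y = Abs_fps (\<lambda>n. if n = 0 then 0 else y ^ n)"

lemma geom_mult: "(1 + geom y) * (1 - fps_const y * fps_X) = 1"
proof -
  have "(1 + geom y) * (1 - fps_const y * fps_X) = 1 + geom y - fps_const y * (fps_X * (1 + geom y))"
    by (simp add: algebra_simps)
  also have "\<dots> = 1"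
    by (rule fps_ext) (simp add: geom_def power_eq_if)
  finally show ?thesis .
qed

lemma fps_X_dvd_if_nth_0: "fps_X dvd f" if "fps_nth f 0 = 0" for f :: "real fps"
proof -
  have "f = fps_X * fps_shift 1 f" by (rule fps_ext) (use that in simp)
  then show ?thesis by (rule dvdI)
qed

text \<open>The recursion is summed over the sizes up to \<open>N\<close>. The truncation leaves the
  error term \<open>?E\<close>, which has order at least \<open>N\<close>, as have the products cut
  off on the right; coefficients below \<open>N\<close> therefore agree.\<close>

lemma support_gf_formula:
  fixes x y :: real
  assumes "n < N"
  shows "fps_nth (\<Sum>m=1..N. geom y * support_gf (fps_const x) (geom 1) m (geom y)) n =
    fps_nth (fps_const x * fps_const y * fps_X * (\<Sum>k<N. \<Prod>i<k.
      1 - (1 - fps_const x * fps_X) * (1 - fps_const y * fps_X) * (1 - fps_X) ^ i)) n"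
proof -
  define X where "X = fps_const x"
  define p where "p = 1 - fps_const y * fps_X"
  define q where "q = 1 - (fps_X :: real fps)"
  define r where "r = 1 - X * fps_X"
  \<comment> \<open>These are the inverses of \<open>p\<close> and \<open>q\<close>, expressed by
    \<open>geom\<close>.\<close>
  define ip iq where "ip = 1 + geom y" and "iq = 1 + geom 1"
  have ip: "ip * p = 1" using geom_mult[of y] by (simp add: ip_def p_def)
  have iq: "iq * q = 1" using geom_mult[of 1] by (simp add: iq_def q_def)
  define s where "s = geom 1"
  \<comment> \<open>The iterates of the substitution: each step multiplies
    \<open>1 + \<zeta> i\<close> by \<open>iq = 1 + s\<close>, and \<open>\<zeta> 0\<close> is
    \<open>geom y\<close>.\<close>
  define \<zeta> where "\<zeta> i = ip * iq ^ i - 1" for i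
  define H where "H = support_gf X s"
  \<comment> \<open>The factor \<open>iq ^ i\<close> turns the functional equation into \<open>T i = X * p + f i * T (Suc i)\<close> up to order \<open>N\<close>.\<close>
  define T where "T i = iq ^ i * (\<Sum>m=1..N. H m (\<zeta> i))" for i
  define f where "f i = 1 - r * p * q ^ i" for i
  have \<zeta>_Suc: "s + \<zeta> i + s * \<zeta> i = \<zeta> (Suc i)" for i
    by (simp add: s_def \<zeta>_def iq_def algebra_simps)
  have f_dvd: "fps_X dvd f i" for i
    by (rule fps_X_dvd_if_nth_0) (simp add: f_def r_def p_def q_def fps_mult_nth_0 fps_nth_power_0)
  have \<zeta>_dvd: "fps_X dvd \<zeta> i" for i
    by (rule fps_X_dvd_if_nth_0) (simp add: \<zeta>_def ip_def iq_def geom_def fps_mult_nth_0 fps_nth_power_0)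
  have s_dvd: "fps_X dvd s"
    by (rule fps_X_dvd_if_nth_0) (simp add: s_def geom_def)
  have "fps_X ^ N dvd T i - (X * p + f i * T (Suc i))" for i
  proof -
    let ?S = "\<lambda>i. \<Sum>m=1..N. H m (\<zeta> i)" and ?E = "H (Suc N) (\<zeta> i)"
    have "(\<Sum>m=1..N. H (Suc m) (\<zeta> i)) = (X * s + \<zeta> i + s * \<zeta> i) * ?S (Suc i) - \<zeta> i * ?S i"
      using support_gf_Suc[of _ X s "\<zeta> i"]
      by (simp add: H_def \<zeta>_Suc sum_subtractf sum_distrib_left)
    \<comment> \<open>The shifted sum loses the term of size one, which is \<open>X\<close>, and
      gains the term of size \<open>Suc N\<close>.\<close>
    moreover have "(\<Sum>m=1..N. H (Suc m) (\<zeta> i)) = ?S i - X + ?E"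
    proof -
      have "(\<Sum>m=1..N. H (Suc m) (\<zeta> i) - H m (\<zeta> i)) = ?E - H 1 (\<zeta> i)"
        using sum_Suc_diff[of 1 N "\<lambda>m. H m (\<zeta> i)"] by simp
      then show ?thesis using support_gf_one[of X s "\<zeta> i"] by (simp add: sum_subtractf H_def algebra_simps)
    qed
    ultimately have step: "?S i - X + ?E = (X * s + \<zeta> i + s * \<zeta> i) * ?S (Suc i) - \<zeta> i * ?S i"
      by simp
    have "?S i * (1 + \<zeta> i) = (?S i - X + ?E) + \<zeta> i * ?S i + X - ?E" by (simp add: algebra_simps)
    then have rec: "?S i * (1 + \<zeta> i) = X - ?E + (X * s + \<zeta> i + s * \<zeta> i) * ?S (Suc i)"
      unfolding step by (simp add: algebra_simps)
    \<comment> \<open>Inserting \<open>ip * p = 1\<close> completes \<open>iq ^ i\<close> to the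
      factor \<open>1 + \<zeta> i\<close> that occurs in \<open>rec\<close>.\<close>
    have "T i = (ip * p) * (iq ^ i * ?S i)" by (simp add: T_def ip)
    also have "\<dots> = p * (?S i * (1 + \<zeta> i))" by (simp add: \<zeta>_def algebra_simps)
    also have "\<dots> = p * X - p * ?E + (p * (X * s + \<zeta> i + s * \<zeta> i)) * ?S (Suc i)"
      unfolding rec by (simp add: algebra_simps)
    also have "p * (X * s + \<zeta> i + s * \<zeta> i) = f i * iq ^ Suc i"
    proof -
      have "X * s + \<zeta> i + s * \<zeta> i = X * (iq - 1) + \<zeta> (Suc i) - (iq - 1)"
        unfolding \<zeta>_Suc[symmetric] by (simp add: s_def iq_def)
      also have "\<dots> = X * (iq - 1) + ip * iq ^ Suc i - iq" by (simp add: \<zeta>_def)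
      \<comment> \<open>Replacing \<open>1\<close> by \<open>iq * q\<close> makes this
        \<open>X * iq * fps_X\<close>, which combines with the last term \<open>- iq\<close> to
        \<open>- iq * r\<close>.\<close>
      also have "\<dots> = X * (iq - iq * q) + ip * iq ^ Suc i - iq" by (simp add: iq)
      also have "\<dots> = ip * iq ^ Suc i - iq * r" by (simp add: q_def r_def algebra_simps)
      finally have eq: "X * s + \<zeta> i + s * \<zeta> i = ip * iq ^ Suc i - iq * r" .
      have "p * (X * s + \<zeta> i + s * \<zeta> i) = (ip * p) * iq ^ Suc i - p * iq * r"
        unfolding eq by (simp add: algebra_simps)
      \<comment> \<open>The inserted power of \<open>iq * q = 1\<close> raises \<open>iq\<close> to
        \<open>iq ^ Suc i\<close> and leaves the factor \<open>q ^ i\<close> of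
        \<open>f i\<close>.\<close>
      also have "\<dots> = iq ^ Suc i - p * r * iq * (iq * q) ^ i" by (simp add: ip iq mult_ac)
      also have "\<dots> = f i * iq ^ Suc i" by (simp add: f_def power_mult_distrib algebra_simps)
      finally show ?thesis .
    qed
    finally have "T i - (X * p + f i * T (Suc i)) = - p * ?E"
      by (simp add: T_def algebra_simps)
    moreover have "fps_X ^ N dvd ?E"
      using support_gf_dvd[OF s_dvd \<zeta>_dvd, of "Suc N" X i] by (simp add: H_def)
    ultimately show ?thesis by simp
  qed
  from unroll_recursion_mod_power[of _ N T "X * p" f, OF this f_dvd]
  have "fps_X ^ N dvd T 0 - X * p * (\<Sum>k<N. \<Prod>i<k. f i)" .
  then have "fps_X ^ N dvd geom y * (T 0 - X * p * (\<Sum>k<N. \<Prod>i<k. f i))" by (rule dvd_mult)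
  also have "\<dots> = geom y * T 0 - X * (geom y * p) * (\<Sum>k<N. \<Prod>i<k. f i)"
    by (simp add: algebra_simps)
  also have "geom y * p = fps_const y * fps_X"
    using ip by (simp add: ip_def p_def algebra_simps)
  finally obtain d where d: "geom y * T 0 - X * (fps_const y * fps_X) * (\<Sum>k<N. \<Prod>i<k. f i) = fps_X ^ N * d"
    by (rule dvdE)
  have "fps_nth (geom y * T 0 - X * (fps_const y * fps_X) * (\<Sum>k<N. \<Prod>i<k. f i)) n = 0"
    unfolding d using assms by (simp add: fps_X_power_mult_nth)
  moreover have "geom y * T 0 = (\<Sum>m=1..N. geom y * support_gf (fps_const x) (geom 1) m (geom y))"
    by (simp add: T_def \<zeta>_def ip_def H_def X_def s_def sum_distrib_left)
  ultimately show ?thesis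
    by (simp add: f_def r_def p_def q_def X_def mult.assoc)
qed

text \<open>In the closed form, exchanging \<open>x\<close> and \<open>y\<close> only permutes
  commuting factors.\<close>

corollary support_gf_symmetric:
  fixes x y :: real
  assumes "n < N"
  shows "fps_nth (\<Sum>m=1..N. geom y * support_gf (fps_const x) (geom 1) m (geom y)) n =
    fps_nth (\<Sum>m=1..N. geom x * support_gf (fps_const y) (geom 1) m (geom x)) n"
  unfolding support_gf_formula[OF assms]
  by (simp only: mult.commute[of "fps_const x" "fps_const y"]
      mult.commute[of "1 - fps_const x * fps_X" "1 - fps_const y * fps_X"])

section \<open>From supports to matrices\<close>

definition matrices_on :: "'c set \<Rightarrow> nat \<Rightarrow> ('c \<Rightarrow> nat) set" where
  "matrices_on A n = {f. {c. f c \<noteq> 0} = A \<and> sum f A = n}"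

lemma matrices_on_insert:
  assumes "finite A" "a \<notin> A"
  shows "matrices_on (insert a A) n = (\<lambda>(i, f). f(a := i)) ` (SIGMA i:{1..n}. matrices_on A (n - i))" (is "?l = ?r")
    and "inj_on (\<lambda>(i, f). f(a := i)) (SIGMA i:{1..n}. matrices_on A (n - i))"
proof -
  have eq: "sum (f(a := i)) A = sum f A" for f :: "'a \<Rightarrow> nat" and i
    using assms(2) by (intro sum.cong) auto
  show "?l = ?r"
  proof
    show "?l \<subseteq> ?r"
    proof
      fix f assume "f \<in> ?l"
      then have f: "{c. f c \<noteq> 0} = insert a A" "f a + sum f A = n"
        using assms by (auto simp: matrices_on_def)
      have "f a \<noteq> 0" using f(1) by blast
      then have "f a \<in> {1..n}" using f(2) by simp
      moreover have "f(a := 0) \<in> matrices_on A (n - f a)"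
        using f assms eq[of f 0] by (auto simp: matrices_on_def)
      moreover have "f = (\<lambda>(i, f). f(a := i)) (f a, f(a := 0))" by simp
      ultimately show "f \<in> ?r" by blast
    qed
    show "?r \<subseteq> ?l"
    proof clarify
      fix i f assume i: "i \<in> {1..n}" and f: "f \<in> matrices_on A (n - i)"
      then show "f(a := i) \<in> matrices_on (insert a A) n"
        using assms eq[of f i] by (auto simp: matrices_on_def)
    qed
  qed
  show "inj_on (\<lambda>(i, f). f(a := i)) (SIGMA i:{1..n}. matrices_on A (n - i))"
  proof (rule inj_onI, clarify)
    fix i f i' f' assume f: "f \<in> matrices_on A (n - i)" "f' \<in> matrices_on A (n - i')"
      and eq: "f(a := i) = f'(a := i')"
    have "f a = 0" "f' a = 0" using f assms(2) by (auto simp: matrices_on_def)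
    then show "i = i' \<and> f = f'" using eq by (metis fun_upd_eqD fun_upd_triv fun_upd_upd)
  qed
qed

lemma matrices_on_empty: "matrices_on {} n = (if n = 0 then {\<lambda>_. 0} else {})"
  by (auto simp: matrices_on_def)

lemma finite_matrices_on: "finite A \<Longrightarrow> finite (matrices_on A n)"
  by (induction A arbitrary: n rule: finite_induct) (simp_all add: matrices_on_empty matrices_on_insert(1))

text \<open>Expanding the product picks a positive exponent of \<open>fps_X\<close> for each cell,
  that is, a matrix with support exactly \<open>A\<close>; the exponents add up to
  \<open>n\<close>.\<close>

lemma prod_geom_nth:
  assumes "finite A"
  shows "fps_nth (\<Prod>c\<in>A. geom (w c)) n = (\<Sum>f\<in>matrices_on A n. \<Prod>c\<in>A. w c ^ f c)"
  using assms
proof (induction A arbitrary: n)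
  case empty
  then show ?case by (simp add: matrices_on_empty)
next
  case (insert a A)
  have "fps_nth (\<Prod>c\<in>insert a A. geom (w c)) n =
      (\<Sum>i=0..n. fps_nth (geom (w a)) i * (\<Sum>f\<in>matrices_on A (n - i). \<Prod>c\<in>A. w c ^ f c))"
    using insert by (simp add: fps_mult_nth)
  \<comment> \<open>The index \<open>0\<close> drops out because \<open>geom\<close> has no constant
    term, just as entries on the support are positive.\<close>
  also have "\<dots> = (\<Sum>i=1..n. w a ^ i * (\<Sum>f\<in>matrices_on A (n - i). \<Prod>c\<in>A. w c ^ f c))"
    by (rule sum.mono_neutral_cong_right) (auto simp: geom_def)
  also have "\<dots> = (\<Sum>(i, f)\<in>(SIGMA i:{1..n}. matrices_on A (n - i)). w a ^ i * (\<Prod>c\<in>A. w c ^ f c))"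
    using insert.hyps by (simp add: sum_distrib_left sum.Sigma finite_matrices_on)
  also have "\<dots> = (\<Sum>(i, f)\<in>(SIGMA i:{1..n}. matrices_on A (n - i)). \<Prod>c\<in>insert a A. w c ^ (f(a := i)) c)"
  proof (rule sum.cong[OF refl], clarify)
    fix i f
    have "(\<Prod>c\<in>A. w c ^ (f(a := i)) c) = (\<Prod>c\<in>A. w c ^ f c)"
      using insert.hyps(2) by (intro prod.cong) auto
    then show "w a ^ i * (\<Prod>c\<in>A. w c ^ f c) = (\<Prod>c\<in>insert a A. w c ^ (f(a := i)) c)"
      using insert.hyps by simp
  qed
  also have "\<dots> = (\<Sum>f\<in>matrices_on (insert a A) n. \<Prod>c\<in>insert a A. w c ^ f c)"
    unfolding matrices_on_insert(1)[OF insert.hyps]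
    by (subst sum.reindex[OF matrices_on_insert(2)[OF insert.hyps]]) (simp add: split_def)
  finally show ?case .
qed

section \<open>Weighted enumeration of Fishburn matrices\<close>

definition fishburn_matrices :: "nat \<Rightarrow> (cell \<Rightarrow> nat) set" where
  "fishburn_matrices n = {f. \<exists>m. fishburn_support m {c. f c \<noteq> 0} \<and> sum f {c. f c \<noteq> 0} = n}"

text \<open>The size is recovered as the largest nonzero column. For the zero matrix the maximum is
  unspecified, but the sum is empty.\<close>

definition last_column_weight :: "(cell \<Rightarrow> nat) \<Rightarrow> nat" where
  "last_column_weight f =
     (\<Sum>c | f c \<noteq> 0 \<and> snd c = Max (snd ` {c. f c \<noteq> 0}). f c)"

text \<open>Matrices are grouped by support and supports by size. Giving units the weight
  \<open>y\<close> in the last column and \<open>1\<close> elsewhere makes the exponent of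
  \<open>y\<close> the last column weight. For \<open>n = 0\<close> the only matrix has size zero,
  which the right-hand side does not count.\<close>

lemma fishburn_matrices_gf:
  fixes x y :: real
  assumes "n \<noteq> 0"
  shows "(\<Sum>f\<in>fishburn_matrices n. x ^ card (ne_cells {c. f c \<noteq> 0}) * y ^ last_column_weight f) =
    fps_nth (\<Sum>m=1..Suc n. geom y * support_gf (fps_const x) (geom 1) m (geom y)) n"
proof -
  define \<S> where "\<S> = (\<lambda>m. {A. fishburn_support m A})"
  let ?supp = "\<lambda>f::cell \<Rightarrow> nat. {c. f c \<noteq> 0}"
  let ?h = "\<lambda>f. x ^ card (ne_cells (?supp f)) * y ^ last_column_weight f"
  have supp: "?supp f \<in> (\<Union>m\<in>{1..Suc n}. \<S> m)" if f: "f \<in> fishburn_matrices n" for f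
  proof -
    obtain m where m: "fishburn_support m (?supp f)" "sum f (?supp f) = n"
      using f by (auto simp: fishburn_matrices_def)
    have "m \<noteq> 0"
    proof
      assume "m = 0"
      then have "?supp f = {}" using fishburn_support_subset[OF m(1)] by simp
      then show False using m(2) assms by (metis sum.empty)
    qed
    \<comment> \<open>The size is at most the number of nonzero cells, hence at most the weight. The
      upper limit \<open>Suc n\<close> of the sum is chosen to exceed \<open>n\<close>, as
      \<open>support_gf_symmetric\<close> requires.\<close>
    moreover have "m \<le> n"
    proof -
      have "card (?supp f) \<le> sum f (?supp f)"
        unfolding card_eq_sum by (rule sum_mono) simp
      then show ?thesis using fishburn_support_card_ge[OF m(1)] m(2) by linarith
    qed
    ultimately show ?thesis using m(1) by (auto simp: \<S>_def)
  qed
  have fin\<S>: "finite (\<S> m)" for m using finite_fishburn_supports by (simp add: \<S>_def)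
  have fin: "finite (\<Union>m\<in>{1..Suc n}. \<S> m)" using fin\<S> by blast
  have eq: "{f \<in> fishburn_matrices n. ?supp f = A} = matrices_on A n"
    if "A \<in> (\<Union>m\<in>{1..Suc n}. \<S> m)" for A
    using that by (auto simp: fishburn_matrices_def matrices_on_def \<S>_def)
  have "fishburn_matrices n \<subseteq> (\<Union>A\<in>(\<Union>m\<in>{1..Suc n}. \<S> m). matrices_on A n)"
  proof
    fix f assume f: "f \<in> fishburn_matrices n"
    then have "f \<in> matrices_on (?supp f) n" using eq[OF supp[OF f]] by blast
    then show "f \<in> (\<Union>A\<in>(\<Union>m\<in>{1..Suc n}. \<S> m). matrices_on A n)" using supp[OF f] by blast
  qed
  moreover have "finite (\<Union>A\<in>(\<Union>m\<in>{1..Suc n}. \<S> m). matrices_on A n)"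
    using fin finite_fishburn_support by (intro finite_UN_I finite_matrices_on) (auto simp: \<S>_def)
  ultimately have finM: "finite (fishburn_matrices n)" by (rule finite_subset)
  have "(\<Sum>f\<in>fishburn_matrices n. ?h f) =
      (\<Sum>A\<in>(\<Union>m\<in>{1..Suc n}. \<S> m). \<Sum>f\<in>{f \<in> fishburn_matrices n. ?supp f = A}. ?h f)"
    by (rule sum.group[symmetric, OF finM fin]) (use supp in blast)
  also have "\<dots> = (\<Sum>A\<in>(\<Union>m\<in>{1..Suc n}. \<S> m). \<Sum>f\<in>matrices_on A n. ?h f)"
    by (rule sum.cong[OF refl]) (simp only: eq)
  also have "\<dots> = (\<Sum>m=1..Suc n. \<Sum>A\<in>\<S> m. \<Sum>f\<in>matrices_on A n. ?h f)"
  proof (rule sum.UNION_disjoint)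
    show "\<forall>m\<in>{1..Suc n}. \<forall>m'\<in>{1..Suc n}. m \<noteq> m' \<longrightarrow> \<S> m \<inter> \<S> m' = {}"
    proof (intro ballI impI equals0I)
      fix m m' A assume "m \<noteq> m'" "A \<in> \<S> m \<inter> \<S> m'"
      then have "{1..m} = {1..m'}" by (auto simp: \<S>_def fishburn_support_def)
      then show False using \<open>m \<noteq> m'\<close> by (metis card_atLeastAtMost diff_Suc_1)
    qed
  qed (use fin\<S> in auto)
  also have "\<dots> = (\<Sum>m=1..Suc n. fps_nth (geom y * support_gf (fps_const x) (geom 1) m (geom y)) n)"
  proof (rule sum.cong[OF refl])
    fix m assume m: "m \<in> {1..Suc n}"
    have "(\<Sum>f\<in>matrices_on A n. ?h f) = fps_nth (geom y * (fps_const x ^ card (ne_cells A) *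
        geom 1 ^ card {c \<in> A. snd c < m} * geom y ^ (card (column A m) - 1))) n" if "A \<in> \<S> m" for A
    proof -
      have A: "fishburn_support m A" using that by (simp add: \<S>_def)
      note finA = finite_fishburn_support[OF A]
      let ?w = "\<lambda>c. if snd c = m then y else 1"
      have Max: "Max (snd ` A) = m"
        using A m by (intro Max_eqI) (auto simp: fishburn_support_def)
      have w: "(\<Prod>c\<in>A. ?w c ^ f c) = y ^ last_column_weight f" if f: "f \<in> matrices_on A n" for f
      proof -
        have supp: "{c. f c \<noteq> 0} = A" using f by (simp add: matrices_on_def)
        have "(\<Prod>c\<in>A. ?w c ^ f c) = (\<Prod>c\<in>A. if snd c = m then y ^ f c else 1)"
          by (intro prod.cong) auto
        also have "\<dots> = (\<Prod>c\<in>{c \<in> A. snd c = m}. y ^ f c)"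
          using finA by (simp add: prod.inter_filter)
        also have "\<dots> = y ^ (\<Sum>c\<in>{c \<in> A. snd c = m}. f c)" by (simp add: power_sum)
        also have "{c \<in> A. snd c = m} = {c. f c \<noteq> 0 \<and> snd c = m}" using supp by blast
        finally show ?thesis unfolding last_column_weight_def supp Max .
      qed
      have "(\<Sum>f\<in>matrices_on A n. ?h f) = (\<Sum>f\<in>matrices_on A n. x ^ card (ne_cells A) * (\<Prod>c\<in>A. ?w c ^ f c))"
        by (rule sum.cong[OF refl]) (simp add: w, simp add: matrices_on_def)
      also have "\<dots> = x ^ card (ne_cells A) * fps_nth (\<Prod>c\<in>A. geom (?w c)) n"
        by (simp add: prod_geom_nth[OF finA] sum_distrib_left)
      also have "(\<Prod>c\<in>A. geom (?w c)) = geom 1 ^ card {c \<in> A. snd c < m} * geom y ^ card (column A m)"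
      proof -
        have A_eq: "A = {c \<in> A. snd c < m} \<union> (\<lambda>i. (i, m)) ` column A m"
          using fishburn_supportD[OF A] by (force simp: column_def)
        have "(\<Prod>c\<in>A. geom (?w c)) = (\<Prod>c\<in>{c \<in> A. snd c < m}. geom (?w c)) * (\<Prod>c\<in>(\<lambda>i. (i, m)) ` column A m. geom (?w c))"
          using finA fishburn_support_column(2)[OF A]
          by (subst A_eq, subst prod.union_disjoint) auto
        then show ?thesis by (simp add: prod.reindex inj_on_def)
      qed
      also have "geom y ^ card (column A m) = geom y * geom y ^ (card (column A m) - 1)"
        using fishburn_support_column[OF A] m by (simp add: power_eq_if card_gt_0_iff)
      finally have eq: "(\<Sum>f\<in>matrices_on A n. ?h f) = x ^ card (ne_cells A) *
          fps_nth (geom 1 ^ card {c \<in> A. snd c < m} * (geom y * geom y ^ (card (column A m) - 1))) n" .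
      have "geom y * (fps_const x ^ card (ne_cells A) * geom 1 ^ card {c \<in> A. snd c < m} * geom y ^ (card (column A m) - 1)) =
          fps_const (x ^ card (ne_cells A)) * (geom 1 ^ card {c \<in> A. snd c < m} * (geom y * geom y ^ (card (column A m) - 1)))"
        by (simp add: fps_const_power mult_ac)
      then show ?thesis unfolding eq by (simp only: fps_mult_left_const_nth)
    qed
    then have "(\<Sum>A\<in>\<S> m. \<Sum>f\<in>matrices_on A n. ?h f) = (\<Sum>A\<in>\<S> m. fps_nth (geom y * (fps_const x ^ card (ne_cells A) *
        geom 1 ^ card {c \<in> A. snd c < m} * geom y ^ (card (column A m) - 1))) n)"
      by (rule sum.cong[OF refl])
    then show "(\<Sum>A\<in>\<S> m. \<Sum>f\<in>matrices_on A n. ?h f) = fps_nth (geom y * support_gf (fps_const x) (geom 1) m (geom y)) n"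
      by (simp add: support_gf_def sum_distrib_left fps_sum_nth \<S>_def)
  qed
  finally show ?thesis by (simp only: fps_sum_nth)
qed

section \<open>Interval orders and Fishburn matrices\<close>

lemma card_vimage_sum:
  assumes "finite X" "finite B"
  shows "card {x \<in> X. p x \<in> B} = (\<Sum>c\<in>B. card {x \<in> X. p x = c})"
proof -
  have "{x \<in> X. p x \<in> B} = (\<Union>c\<in>B. {x \<in> X. p x = c})" by auto
  moreover have "card (\<Union>c\<in>B. {x \<in> X. p x = c}) = (\<Sum>c\<in>B. card {x \<in> X. p x = c})"
    by (rule card_UN_disjoint) (use assms in auto)
  ultimately show ?thesis by simp
qed

text \<open>Bijections between corresponding fibres are glued together. This turns equality of
  Fishburn matrices into an isomorphism.\<close>

lemma bij_betw_equal_fibres: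
  assumes "finite X" "finite Y" "\<And>c. card {x \<in> X. p x = c} = card {y \<in> Y. q y = c}"
  shows "\<exists>f. bij_betw f X Y \<and> (\<forall>x\<in>X. q (f x) = p x)"
proof -
  have "\<exists>h. bij_betw h {x \<in> X. p x = c} {y \<in> Y. q y = c}" for c
    using assms by (intro finite_same_card_bij) auto
  then obtain h where h: "\<And>c. bij_betw (h c) {x \<in> X. p x = c} {y \<in> Y. q y = c}" by metis
  define f where "f x = h (p x) x" for x
  have f: "f x \<in> Y" "q (f x) = p x" if "x \<in> X" for x
    using bij_betwE[OF h, of "p x"] that by (auto simp: f_def)
  have "inj_on f X"
  proof (rule inj_onI)
    fix x x' assume x: "x \<in> X" "x' \<in> X" "f x = f x'"
    then have "p x = p x'" using f by metis
    then show "x = x'" using x bij_betw_imp_inj_on[OF h, of "p x"] by (auto simp: f_def inj_on_def)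
  qed
  moreover have "f ` X = Y"
  proof
    show "Y \<subseteq> f ` X"
    proof
      fix y assume "y \<in> Y"
      then have "y \<in> h (q y) ` {x \<in> X. p x = q y}"
        using bij_betw_imp_surj_on[OF h, of "q y"] by auto
      then obtain x where x: "x \<in> X" "p x = q y" "y = h (q y) x" by blast
      then have "y = f x" by (simp add: f_def)
      then show "y \<in> f ` X" using x(1) by blast
    qed
  qed (use f in auto)
  ultimately show ?thesis using f by (auto simp: bij_betw_def)
qed

text \<open>The \<open>n\<close> elements are matched with the disjoint union of \<open>f c\<close>
  copies of each \<open>c\<close>; this distributes them over the cells of a given matrix.\<close>

lemma function_with_fibre_cards:
  assumes "finite A" "sum f A = n"
  shows "\<exists>p. p ` {..<n} \<subseteq> A \<and> (\<forall>c\<in>A. card {x \<in> {..<n}. p x = c} = f c)"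
proof -
  let ?S = "SIGMA c:A. {..<f c}"
  have "finite ?S" "card ?S = n" using assms by auto
  then obtain h where h: "bij_betw h {..<n} ?S"
    using ex_bij_betw_nat_finite[of ?S] by (auto simp: atLeast0LessThan)
  have "card {x \<in> {..<n}. fst (h x) = c} = f c" if "c \<in> A" for c
  proof -
    have bij: "bij_betw h {x \<in> {..<n}. fst (h x) = c} (h ` {x \<in> {..<n}. fst (h x) = c})"
      using h by (rule bij_betw_subset) auto
    have image: "h ` {x \<in> {..<n}. fst (h x) = c} = {c} \<times> {..<f c}"
    proof -
      have "h ` {x \<in> {..<n}. fst (h x) = c} = {z \<in> h ` {..<n}. fst z = c}" by auto
      also have "\<dots> = {c} \<times> {..<f c}"
        using that unfolding bij_betw_imp_surj_on[OF h] by auto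
      finally show ?thesis .
    qed
    show ?thesis using bij_betw_same_card[OF bij] unfolding image by (simp add: card_cartesian_product)
  qed
  moreover have "(\<lambda>x. fst (h x)) ` {..<n} \<subseteq> A"
  proof (rule image_subsetI)
    fix x assume "x \<in> {..<n}"
    then have "h x \<in> ?S" using bij_betwE[OF h] by blast
    then show "fst (h x) \<in> A" by (cases "h x") auto
  qed
  ultimately show ?thesis by blast
qed

section \<open>The Fishburn matrix of an isomorphism class\<close>

definition represented :: "nat \<Rightarrow> nat rel set \<Rightarrow> (cell \<Rightarrow> nat) \<Rightarrow> bool" where
  "represented n C f \<longleftrightarrow> (\<exists>R\<in>C. \<exists>m l r. minimal_representation {..<n} R m l r \<and>
     f = (\<lambda>c. card (cell_elements {..<n} l r c)))"

lemma represented_exists: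
  assumes "C \<in> interval_order_classes n"
  shows "\<exists>f. represented n C f"
proof -
  obtain R where "R \<in> C"
    using in_quotient_imp_non_empty[OF equiv_isomorphic_orders] assms
    unfolding interval_order_classes_def by blast
  moreover obtain m l r where "minimal_representation {..<n} R m l r"
    using minimal_representation_exists[OF finite_lessThan interval_order_classes_iso(1)[OF assms \<open>R \<in> C\<close> \<open>R \<in> C\<close>]]
    by blast
  ultimately show ?thesis unfolding represented_def by blast
qed

lemma poset_iso_minimal_representation:
  assumes "poset_iso X R Y R' f" "minimal_representation Y R' m l r"
  shows "minimal_representation X R m (l \<circ> f) (r \<circ> f)"
proof -
  have fX: "f ` X = Y" and rel: "\<And>x y. x \<in> X \<Longrightarrow> y \<in> X \<Longrightarrow> (x, y) \<in> R \<longleftrightarrow> (f x, f y) \<in> R'"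
    using assms(1) unfolding poset_iso_def bij_betw_def by auto
  show ?thesis
    using assms(2) rel unfolding minimal_representation_def fX[symmetric] by (auto simp: image_image)
qed

text \<open>In \<open>represented\<close> both the representative and its minimal representation are
  arbitrary. An isomorphism transports minimal representations, and these are unique, so
  corresponding elements lie in the same cell.\<close>

lemma represented_unique:
  assumes C: "C \<in> interval_order_classes n" and f: "represented n C f" and g: "represented n C g"
  shows "f = g"
proof -
  let ?X = "{..<n}"
  obtain R m l r where R: "R \<in> C" "minimal_representation ?X R m l r"
    and f: "f = (\<lambda>c. card (cell_elements ?X l r c))" using f unfolding represented_def by blast
  obtain R' m' l' r' where R': "R' \<in> C" "minimal_representation ?X R' m' l' r'"
    and g: "g = (\<lambda>c. card (cell_elements ?X l' r' c))" using g unfolding represented_def by blast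
  obtain h where h: "poset_iso ?X R ?X R' h"
    using interval_order_classes_iso(2)[OF C R(1) R'(1)] by blast
  have bij: "bij_betw h ?X ?X" using h by (simp add: poset_iso_def)
  have eq: "l x = l' (h x)" "r x = r' (h x)" if "x \<in> ?X" for x
    using minimal_representation_unique[OF R(2) poset_iso_minimal_representation[OF h R'(2)] that] by simp_all
  have "f c = g c" for c
  proof -
    have "h ` cell_elements ?X l r c = cell_elements ?X l' r' c"
    proof -
      have "cell_elements ?X l r c = {x \<in> ?X. cell_of l' r' (h x) = c}"
        using eq by (auto simp: cell_elements_def cell_of_def)
      then have "h ` cell_elements ?X l r c = {y \<in> h ` ?X. cell_of l' r' y = c}" by auto
      then show ?thesis by (simp add: bij_betw_imp_surj_on[OF bij] cell_elements_def)
    qed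
    moreover have "inj_on h (cell_elements ?X l r c)"
      using bij_betw_imp_inj_on[OF bij] by (rule inj_on_subset) (auto simp: cell_elements_def)
    ultimately show ?thesis unfolding f g by (metis card_image)
  qed
  then show ?thesis by blast
qed

text \<open>Equal entries yield a bijection that preserves cells. Since the order between two
  elements depends only on their cells, it is an isomorphism.\<close>

lemma represented_inject:
  assumes C: "C \<in> interval_order_classes n" and C': "C' \<in> interval_order_classes n"
    and f: "represented n C f" and g: "represented n C' f"
  shows "C = C'"
proof -
  let ?X = "{..<n}"
  obtain R m l r where R: "R \<in> C" "minimal_representation ?X R m l r"
    and f: "f = (\<lambda>c. card (cell_elements ?X l r c))" using f unfolding represented_def by blast
  obtain R' m' l' r' where R': "R' \<in> C'" "minimal_representation ?X R' m' l' r'"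
    and g: "f = (\<lambda>c. card (cell_elements ?X l' r' c))" using g unfolding represented_def by blast
  have "card {x \<in> ?X. cell_of l r x = c} = card {x \<in> ?X. cell_of l' r' x = c}" for c
    using fun_cong[OF trans[OF f[symmetric] g], of c] by (simp add: cell_elements_def)
  then obtain h where h: "bij_betw h ?X ?X" "\<And>x. x \<in> ?X \<Longrightarrow> cell_of l' r' (h x) = cell_of l r x"
    using bij_betw_equal_fibres[of ?X ?X "cell_of l r" "cell_of l' r'"] by auto
  have "(x, y) \<in> R \<longleftrightarrow> (h x, h y) \<in> R'" if "x \<in> ?X" "y \<in> ?X" for x y
  proof -
    have hX: "h x \<in> ?X" "h y \<in> ?X" using bij_betwE[OF h(1)] that by blast+
    have "r' (h x) = r x" "l' (h y) = l y" using h(2)[OF that(1)] h(2)[OF that(2)] by (auto simp: cell_of_def)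
    then show ?thesis
      using R(2) R'(2) that hX unfolding minimal_representation_def by metis
  qed
  then have "poset_iso ?X R ?X R' h" using h(1) by (simp add: poset_iso_def)
  then have "(R, R') \<in> isomorphic_orders n"
    using interval_order_classes_iso(1)[OF C R(1) R(1)] interval_order_classes_iso(1)[OF C' R'(1) R'(1)]
    by (auto simp: isomorphic_orders_def)
  then show ?thesis
    using quotient_eq_iff[OF equiv_isomorphic_orders] C C' R(1) R'(1) unfolding interval_order_classes_def by blast
qed

lemma minimal_representation_support:
  assumes "minimal_representation X R m l r" "finite X"
  shows "{c. card (cell_elements X l r c) \<noteq> 0} = cell_of l r ` X"
    and "fishburn_support m (cell_of l r ` X)"
proof -
  show "{c. card (cell_elements X l r c) \<noteq> 0} = cell_of l r ` X"
    using assms(2) by (auto simp: cell_elements_def intro: rev_image_eqI)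
  show "fishburn_support m (cell_of l r ` X)"
    using assms(1) by (auto simp: fishburn_support_def minimal_representation_def cell_of_def image_image)
qed

lemma represented_fishburn_matrix:
  assumes "represented n C f"
  shows "f \<in> fishburn_matrices n"
proof -
  let ?X = "{..<n}"
  obtain R m l r where R: "minimal_representation ?X R m l r"
    and f: "f = (\<lambda>c. card (cell_elements ?X l r c))" using assms unfolding represented_def by blast
  note supp = minimal_representation_support[OF R finite_lessThan]
  have "sum f (cell_of l r ` ?X) = card {x \<in> ?X. cell_of l r x \<in> cell_of l r ` ?X}"
    unfolding f cell_elements_def by (rule card_vimage_sum[symmetric]) simp_all
  also have "{x \<in> ?X. cell_of l r x \<in> cell_of l r ` ?X} = ?X" by blast
  finally have "sum f (cell_of l r ` ?X) = n" by simp
  moreover have "{c. f c \<noteq> 0} = cell_of l r ` ?X" unfolding f by (rule supp(1))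
  ultimately show ?thesis using supp(2) unfolding fishburn_matrices_def by auto
qed

text \<open>If two intervals both have successors, the one that ends first also precedes the
  successor of the other, which rules out an induced 2+2.\<close>

lemma interval_order_of_intervals:
  assumes "\<And>x. x \<in> X \<Longrightarrow> l x \<le> (r x :: nat)"
  shows "interval_order_on X {(x, y). x \<in> X \<and> y \<in> X \<and> r x < l y}"
proof -
  let ?R = "{(x, y). x \<in> X \<and> y \<in> X \<and> r x < l y}"
  have "irrefl ?R" using assms by (fastforce simp: irrefl_def)
  moreover have "trans ?R"
  proof (rule transI)
    fix x y z assume "(x, y) \<in> ?R" "(y, z) \<in> ?R"
    then show "(x, z) \<in> ?R" using assms[of y] by auto
  qed
  moreover have "two_plus_two_free X ?R"
    unfolding two_plus_two_free_def
  proof clarify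
    fix a b c d assume X: "a \<in> X" "b \<in> X" "c \<in> X" "d \<in> X" and dist: "distinct [a, b, c, d]"
      and eq: "Restr ?R {a, b, c, d} = {(a, b), (c, d)}"
    have "(a, b) \<in> Restr ?R {a, b, c, d}" "(c, d) \<in> Restr ?R {a, b, c, d}" unfolding eq by simp_all
    then have lt: "r a < l b" "r c < l d" by auto
    have "(a, d) \<notin> Restr ?R {a, b, c, d}" "(c, b) \<notin> Restr ?R {a, b, c, d}"
      unfolding eq using dist by auto
    then have "\<not> r a < l d" "\<not> r c < l b" using X by auto
    then show False using lt by linarith
  qed
  ultimately show ?thesis unfolding interval_order_on_def by auto
qed

text \<open>Elements are distributed over the cells as the entries prescribe, and each cell is read
  as an interval. That no row and no column is zero is exactly the minimality of this
  representation.\<close>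

lemma fishburn_matrix_represented:
  assumes "f \<in> fishburn_matrices n"
  shows "\<exists>C\<in>interval_order_classes n. represented n C f"
proof -
  let ?X = "{..<n}"
  let ?A = "{c. f c \<noteq> 0}"
  obtain m where m: "fishburn_support m ?A" "sum f ?A = n"
    using assms by (auto simp: fishburn_matrices_def)
  obtain p where p: "p ` ?X \<subseteq> ?A" "\<And>c. c \<in> ?A \<Longrightarrow> card {x \<in> ?X. p x = c} = f c"
    using function_with_fibre_cards[OF finite_fishburn_support[OF m(1)] m(2)] by blast
  have "?A \<subseteq> p ` ?X"
  proof
    fix c assume c: "c \<in> ?A"
    then have "card {x \<in> ?X. p x = c} \<noteq> 0" using p(2) by simp
    then have "{x \<in> ?X. p x = c} \<noteq> {}" by (metis card.empty)
    then show "c \<in> p ` ?X" by blast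
  qed
  with p(1) have pX: "p ` ?X = ?A" by (rule subset_antisym)
  define l where "l = fst \<circ> p"
  define r where "r = snd \<circ> p"
  define R where "R = {(x, y). x \<in> ?X \<and> y \<in> ?X \<and> r x < l y}"
  have le: "l x \<le> r x" if "x \<in> ?X" for x
  proof -
    have "p x \<in> ?A" using pX that by blast
    then show ?thesis using m(1) unfolding fishburn_support_def l_def r_def by auto
  qed
  have "interval_order_on ?X R"
    unfolding R_def using le by (rule interval_order_of_intervals)
  moreover have mr: "minimal_representation ?X R m l r"
  proof -
    have "l ` ?X = fst ` ?A" "r ` ?X = snd ` ?A" unfolding pX[symmetric] l_def r_def by (simp_all add: image_comp)
    then have "l ` ?X = {1..m}" "r ` ?X = {1..m}" using m(1) by (simp_all add: fishburn_support_def)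
    then show ?thesis using le by (simp add: minimal_representation_def R_def)
  qed
  moreover have "f = (\<lambda>c. card (cell_elements ?X l r c))"
  proof
    fix c
    have "cell_of l r x = p x" for x by (simp add: cell_of_def l_def r_def)
    then have eq: "cell_elements ?X l r c = {x \<in> ?X. p x = c}" by (simp add: cell_elements_def)
    show "f c = card (cell_elements ?X l r c)"
    proof (cases "c \<in> ?A")
      case True
      then show ?thesis using p(2) eq by simp
    next
      case False
      then have "{x \<in> ?X. p x = c} = {}" using pX by blast
      then show ?thesis using False eq by simp
    qed
  qed
  moreover have "R \<in> isomorphic_orders n `` {R}" if "interval_order_on ?X R"
    using equiv_class_self[OF equiv_isomorphic_orders] that by blast
  ultimately show ?thesis
    unfolding interval_order_classes_def represented_def by (blast intro: quotientI)
qed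

definition fishburn_matrix :: "nat \<Rightarrow> nat rel set \<Rightarrow> cell \<Rightarrow> nat" where
  "fishburn_matrix n C = (THE f. represented n C f)"

lemma represented_fishburn_matrix_of:
  assumes "C \<in> interval_order_classes n"
  shows "represented n C (fishburn_matrix n C)"
  unfolding fishburn_matrix_def
  using represented_exists[OF assms] represented_unique[OF assms] by (metis theI)

lemma bij_betw_fishburn_matrix:
  "bij_betw (fishburn_matrix n) (interval_order_classes n) (fishburn_matrices n)"
  unfolding bij_betw_def
proof
  show "inj_on (fishburn_matrix n) (interval_order_classes n)"
    by (rule inj_onI) (metis represented_fishburn_matrix_of represented_inject)
  show "fishburn_matrix n ` interval_order_classes n = fishburn_matrices n"
  proof
    show "fishburn_matrices n \<subseteq> fishburn_matrix n ` interval_order_classes n"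
      using fishburn_matrix_represented represented_fishburn_matrix_of represented_unique by (metis imageI subsetI)
  qed (use represented_fishburn_matrix_of represented_fishburn_matrix in blast)
qed

text \<open>The first equation is \<open>num_max_F1\<close>. For the second, an element is
  \<open>R\<close>-maximal exactly when its right endpoint is \<open>m\<close>, because
  \<open>m\<close> is itself a left endpoint; these elements make up the last column.\<close>

lemma represented_statistics:
  assumes C: "C \<in> interval_order_classes n" and f: "represented n C f"
  shows "max_S1 n C = card (ne_cells {c. f c \<noteq> 0})" and "max_R n C = last_column_weight f"
proof -
  let ?X = "{..<n}"
  obtain R m l r where R: "R \<in> C" and mr: "minimal_representation ?X R m l r"
    and f: "f = (\<lambda>c. card (cell_elements ?X l r c))" using f unfolding represented_def by blast
  note supp' = minimal_representation_support[OF mr finite_lessThan]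
  have supp: "{c. f c \<noteq> 0} = cell_of l r ` ?X" unfolding f by (rule supp'(1))
  obtain T S where F: "F1_triple ?X T S R"
    using F1_triple_exists[OF finite_lessThan interval_order_classes_iso(1)[OF C R R]] by blast
  show "max_S1 n C = card (ne_cells {c. f c \<noteq> 0})"
    unfolding max_S1_class[OF C R F] num_max_F1[OF finite_lessThan mr F] supp ne_cells_def ..
  have lX: "l ` ?X = {1..m}" and rX: "r ` ?X = {1..m}"
    and rel: "\<And>x y. x \<in> ?X \<Longrightarrow> y \<in> ?X \<Longrightarrow> (x, y) \<in> R \<longleftrightarrow> r x < l y"
    using mr by (auto simp: minimal_representation_def)
  have max: "(\<forall>y\<in>?X. (x, y) \<notin> R) \<longleftrightarrow> r x = m" if x: "x \<in> ?X" for x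
  proof -
    have rx: "r x \<in> {1..m}" using rX x by blast
    have "(\<forall>y\<in>?X. (x, y) \<notin> R) \<longleftrightarrow> (\<forall>k\<in>l ` ?X. \<not> r x < k)" using rel[OF x] by simp
    also have "\<dots> \<longleftrightarrow> r x = m" unfolding lX using rx by (auto simp: not_less intro: le_antisym)
    finally show ?thesis .
  qed
  let ?B = "{c. f c \<noteq> 0 \<and> snd c = Max (snd ` {c. f c \<noteq> 0})}"
  have "snd ` {c. f c \<noteq> 0} = r ` ?X" unfolding supp by (simp add: image_image cell_of_def)
  then have sX: "snd ` {c. f c \<noteq> 0} = {1..m}" using rX by simp
  have "{x \<in> ?X. \<not> (\<exists>y\<in>?X. (x, y) \<in> R)} = {x \<in> ?X. cell_of l r x \<in> ?B}"
  proof (rule Collect_cong, rule conj_cong[OF refl])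
    fix x assume x: "x \<in> ?X"
    have "r x \<in> {1..m}" using rX x by blast
    then have "Max {1..m} = m" by (intro Max_eqI) auto
    moreover have "f (cell_of l r x) \<noteq> 0" using supp x by blast
    ultimately show "(\<not> (\<exists>y\<in>?X. (x, y) \<in> R)) = (cell_of l r x \<in> ?B)"
      unfolding sX using max[OF x] by (simp add: cell_of_def)
  qed
  moreover have "card {x \<in> ?X. cell_of l r x \<in> ?B} = (\<Sum>c\<in>?B. f c)"
  proof -
    have "finite {c. f c \<noteq> 0}" unfolding supp by simp
    then have "finite ?B" by (rule rev_finite_subset) auto
    then show ?thesis by (subst card_vimage_sum) (simp_all add: f cell_elements_def)
  qed
  ultimately show "max_R n C = last_column_weight f"
    unfolding max_R_class[OF C R] num_max_def last_column_weight_def by simp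
qed

section \<open>Comparison of coefficients and conclusion\<close>

lemma power_sum_coefficients:
  fixes u v :: "'c \<Rightarrow> real" and a b :: "'c \<Rightarrow> nat"
  assumes "finite S" "finite T" "\<And>x. (\<Sum>C\<in>S. u C * x ^ a C) = (\<Sum>C\<in>T. v C * x ^ b C)"
  shows "(\<Sum>C | C \<in> S \<and> a C = k. u C) = (\<Sum>C | C \<in> T \<and> b C = k. v C)"
proof -
  let ?p = "\<Sum>C\<in>S. monom (u C) (a C)" and ?q = "\<Sum>C\<in>T. monom (v C) (b C)"
  have "poly ?p = poly ?q"
    by (rule ext) (simp add: poly_sum poly_monom assms(3))
  then have "coeff ?p k = coeff ?q k" by (simp only: poly_eq_poly_eq_iff)
  then show ?thesis using assms(1,2) by (simp add: coeff_sum sum.inter_filter)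
qed

theorem theorem3p7:
  fixes n k l :: nat
  shows "card {C \<in> interval_order_classes n. max_S1 n C = k \<and> max_R n C = l} =
         card {C \<in> interval_order_classes n. max_S1 n C = l \<and> max_R n C = k}"
proof (cases "n = 0")
  case True
  \<comment> \<open>On the empty order both statistics vanish; it is treated apart because the
    generating function starts at size one.\<close>
  have "max_S1 n C = max_R n C" if C: "C \<in> interval_order_classes n" for C
  proof -
    have rep: "represented n C (fishburn_matrix n C)" by (rule represented_fishburn_matrix_of[OF C])
    then have "fishburn_matrix n C = (\<lambda>_. 0)"
      using True by (auto simp: represented_def cell_elements_def)
    then show ?thesis
      unfolding represented_statistics[OF C rep] last_column_weight_def ne_cells_def by simp
  qed
  then have "{C \<in> interval_order_classes n. max_S1 n C = k \<and> max_R n C = l} =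
      {C \<in> interval_order_classes n. max_S1 n C = l \<and> max_R n C = k}" by auto
  then show ?thesis by simp
next
  case False
  let ?\<C> = "interval_order_classes n"
  have gf: "(\<Sum>C\<in>?\<C>. x ^ max_S1 n C * y ^ max_R n C) =
      fps_nth (\<Sum>m=1..Suc n. geom y * support_gf (fps_const x) (geom 1) m (geom y)) n" for x y
  proof -
    have "(\<Sum>C\<in>?\<C>. x ^ max_S1 n C * y ^ max_R n C) = (\<Sum>C\<in>?\<C>.
        x ^ card (ne_cells {c. fishburn_matrix n C c \<noteq> 0}) * y ^ last_column_weight (fishburn_matrix n C))"
      by (rule sum.cong[OF refl]) (simp only: represented_statistics[OF _ represented_fishburn_matrix_of])
    also have "\<dots> = (\<Sum>f\<in>fishburn_matrices n. x ^ card (ne_cells {c. f c \<noteq> 0}) * y ^ last_column_weight f)"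
      by (rule sum.reindex_bij_betw[OF bij_betw_fishburn_matrix])
    finally show ?thesis unfolding fishburn_matrices_gf[OF False] .
  qed
  have sym: "(\<Sum>C\<in>?\<C>. y ^ max_R n C * x ^ max_S1 n C) = (\<Sum>C\<in>?\<C>. y ^ max_S1 n C * x ^ max_R n C)" for x y :: real
    using gf[of x y] gf[of y x] support_gf_symmetric[of n "Suc n" y x] by (simp add: mult.commute)
  note fin = finite_interval_order_classes[of n]
  \<comment> \<open>The identity holds for all real \<open>x\<close> and \<open>y\<close>.
    Coefficients are compared first in \<open>x\<close>, with the powers of \<open>y\<close> as
    coefficients, and then in \<open>y\<close>, where the factor \<open>1\<close> is the
    coefficient.\<close>
  have "(\<Sum>C | C \<in> ?\<C> \<and> max_S1 n C = k. 1 * y ^ max_R n C) =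
      (\<Sum>C | C \<in> ?\<C> \<and> max_R n C = k. 1 * y ^ max_S1 n C)" for y :: real
    using power_sum_coefficients[OF fin fin sym] by simp
  from power_sum_coefficients[OF _ _ this, of l] fin
  have "real (card {C. (C \<in> ?\<C> \<and> max_S1 n C = k) \<and> max_R n C = l}) =
      real (card {C. (C \<in> ?\<C> \<and> max_R n C = k) \<and> max_S1 n C = l})"
    by simp
  then show ?thesis by (simp add: conj_ac)
qed

end
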